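(* Let $\{A_i\mid i\in I\}$ be an arbitrary indexed family of isomorphic torsion-free nilpotent groups with common subgroup $C=\bigcap_{i\in I}A_i$, where the copies of $C$ in the factors correspond under the isomorphisms between the factors; that is, there are a torsion-free nilpotent group $A$, a subgroup $C\le A$, and isomorphisms $\theta_i:A\to A_i$ $(i\in I)$, and the amalgamated subgroups are the $\theta_i(C)$, identified by $\theta_i(c)=\theta_j(c)$ for all $c\in C$, $i,j\in I$. Let $G=\{\prod^{*}_{i\in I}A_i;\ C\}$ be the generalized free product of the $A_i$ amalgamated by $C$. Then $G$ is an extension of a free group by a nilpotent group. Furthermore, $G$ is residually solvable.
   Context: The generalized free product $\{\prod^{*}_{i\in I}A_i;\ C\}$ is the quotient of the free product of the $A_i$ by the normal closure of the elements $\theta_i(c)\theta_j(c)^{-1}$ ($c\in C$, $i,j\in I$). A group $G$ is an extension of $N$ by $Q$ if there is a short exact sequence $1\to N\to G\to Q\to 1$. A group $G$ is residually solvable if for every non-identity $g\in G$ there is a homomorphism from $G$ onto a solvable group under which the image of $g$ is not the identity. *)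

theory Defs
  imports "HOL-Algebra.Exact_Sequence"
begin

section \<open>Words modulo relations\<close>

inductive_set word_cong :: "('a list \<times> 'a list) set \<Rightarrow> ('a list \<times> 'a list) set"
  for R :: "('a list \<times> 'a list) set"
where
  rel: "(u, v) \<in> R \<Longrightarrow> (u, v) \<in> word_cong R"
| refl: "(u, u) \<in> word_cong R"
| sym: "(u, v) \<in> word_cong R \<Longrightarrow> (v, u) \<in> word_cong R"
| trans: "(u, v) \<in> word_cong R \<Longrightarrow> (v, w) \<in> word_cong R \<Longrightarrow> (u, w) \<in> word_cong R"
| append: "(u, v) \<in> word_cong R \<Longrightarrow> (u', v') \<in> word_cong R \<Longrightarrow> (u @ u', v @ v') \<in> word_cong R"

text \<open>
  The monoid presented by the alphabet \<open>S\<close> and the relations \<open>R\<close>.  It is only used with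
  \<open>R \<subseteq> lists S \<times> lists S\<close>, in which case the class of a word over \<open>S\<close> consists of words over \<open>S\<close>.
\<close>

definition word_monoid :: "'a set \<Rightarrow> ('a list \<times> 'a list) set \<Rightarrow> 'a list set monoid" where
  "word_monoid S R =
     \<lparr>carrier = lists S // word_cong R,
      monoid.mult = (\<lambda>U V. \<Union>u\<in>U. \<Union>v\<in>V. word_cong R `` {u @ v}),
      one = word_cong R `` {[]}\<rparr>"

lemma equiv_word_cong: "equiv UNIV (word_cong R)"
  by (auto simp: equiv_def refl_on_def sym_def trans_def
      intro: word_cong.refl word_cong.sym word_cong.trans)

lemma word_cong_class_eq_iff: "word_cong R `` {u} = word_cong R `` {v} \<longleftrightarrow> (u, v) \<in> word_cong R"
  by (rule eq_equiv_class_iff[OF equiv_word_cong]) auto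

lemma word_monoid_mult_class:
  "word_cong R `` {u} \<otimes>\<^bsub>word_monoid S R\<^esub> word_cong R `` {v} = word_cong R `` {u @ v}"
proof -
  have "word_cong R `` {u' @ v'} = word_cong R `` {u @ v}"
    if "(u, u') \<in> word_cong R" "(v, v') \<in> word_cong R" for u' v'
    using word_cong.append[OF that] by (metis word_cong_class_eq_iff)
  then show ?thesis
    unfolding word_monoid_def by (auto intro: word_cong.refl)
qed

lemma group_word_monoid:
  assumes "\<And>x. x \<in> S \<Longrightarrow> \<exists>y\<in>S. ([y, x], []) \<in> word_cong R"
  shows "group (word_monoid S R)"
proof (rule groupI)
  have left_inverse: "\<exists>v\<in>lists S. (v @ u, []) \<in> word_cong R" if "u \<in> lists S" for u
    using that
  proof (induction u)
    case Nil
    then show ?case using word_cong.refl by fastforce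
  next
    case (Cons x u)
    then obtain v where v: "v \<in> lists S" "(v @ u, []) \<in> word_cong R" by auto
    obtain y where y: "y \<in> S" "([y, x], []) \<in> word_cong R"
      using assms Cons.hyps by blast
    have "(v @ ([y, x] @ u), v @ ([] @ u)) \<in> word_cong R"
      by (intro word_cong.append word_cong.refl y)
    with v y show ?case
      by (intro bexI[of _ "v @ [y]"]) (auto intro: word_cong.trans)
  qed
  fix U assume "U \<in> carrier (word_monoid S R)"
  then obtain u where u: "u \<in> lists S" "U = word_cong R `` {u}"
    by (auto simp: word_monoid_def quotient_def)
  then obtain v where "v \<in> lists S" "(v @ u, []) \<in> word_cong R"
    using left_inverse by blast
  then have v: "word_cong R `` {v} \<in> carrier (word_monoid S R)"
    and eq: "word_cong R `` {v @ u} = \<one>\<^bsub>word_monoid S R\<^esub>"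
    by (simp_all only: word_monoid_def monoid.simps partial_object.simps quotientI word_cong_class_eq_iff)
  show "\<exists>V\<in>carrier (word_monoid S R). V \<otimes>\<^bsub>word_monoid S R\<^esub> U = \<one>\<^bsub>word_monoid S R\<^esub>"
    by (rule bexI[OF _ v]) (simp add: u(2) word_monoid_mult_class eq)
next
  fix U V
  assume "U \<in> carrier (word_monoid S R)" "V \<in> carrier (word_monoid S R)"
  then obtain u v where "u \<in> lists S" "U = word_cong R `` {u}" "v \<in> lists S" "V = word_cong R `` {v}"
    by (auto simp: word_monoid_def quotient_def)
  moreover from this have "u @ v \<in> lists S" by simp
  ultimately show "U \<otimes>\<^bsub>word_monoid S R\<^esub> V \<in> carrier (word_monoid S R)"
    by (simp only: word_monoid_mult_class) (simp add: word_monoid_def quotientI)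
next
  show "\<one>\<^bsub>word_monoid S R\<^esub> \<in> carrier (word_monoid S R)"
    by (simp add: word_monoid_def quotientI)
next
  fix U V W
  assume "U \<in> carrier (word_monoid S R)" "V \<in> carrier (word_monoid S R)"
    "W \<in> carrier (word_monoid S R)"
  then obtain u v w where "U = word_cong R `` {u}" "V = word_cong R `` {v}" "W = word_cong R `` {w}"
    by (auto simp: word_monoid_def quotient_def)
  then show "U \<otimes>\<^bsub>word_monoid S R\<^esub> V \<otimes>\<^bsub>word_monoid S R\<^esub> W
      = U \<otimes>\<^bsub>word_monoid S R\<^esub> (V \<otimes>\<^bsub>word_monoid S R\<^esub> W)"
    by (simp add: word_monoid_mult_class)
next
  fix U assume "U \<in> carrier (word_monoid S R)"
  then obtain u where "U = word_cong R `` {u}"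
    by (auto simp: word_monoid_def quotient_def)
  moreover have "\<one>\<^bsub>word_monoid S R\<^esub> = word_cong R `` {[]}"
    by (simp add: word_monoid_def)
  ultimately show "\<one>\<^bsub>word_monoid S R\<^esub> \<otimes>\<^bsub>word_monoid S R\<^esub> U = U"
    by (simp add: word_monoid_mult_class)
qed


section \<open>Free groups\<close>

text \<open>The letter \<open>(x, True)\<close> stands for the generator \<open>x\<close> and \<open>(x, False)\<close> for its inverse.\<close>

definition free_group_rels :: "'x set \<Rightarrow> (('x \<times> bool) list \<times> ('x \<times> bool) list) set" where
  "free_group_rels X = {([(x, b), (x, \<not> b)], []) | x b. x \<in> X}"

definition free_group :: "'x set \<Rightarrow> ('x \<times> bool) list set monoid" where
  "free_group X = word_monoid (X \<times> UNIV) (free_group_rels X)"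

lemma group_free_group: "group (free_group X)"
  unfolding free_group_def
proof (rule group_word_monoid)
  fix p assume "p \<in> X \<times> (UNIV :: bool set)"
  then obtain x b where "p = (x, b)" "x \<in> X" by blast
  then show "\<exists>q\<in>X \<times> UNIV. ([q, p], []) \<in> word_cong (free_group_rels X)"
    by (intro bexI[of _ "(x, \<not> b)"] word_cong.rel) (force simp: free_group_rels_def)+
qed

text \<open>A basis may be taken inside the group, so bases in the carrier type suffice.\<close>

definition is_free_group :: "('a, 'm) monoid_scheme \<Rightarrow> bool" where
  "is_free_group G \<longleftrightarrow> group G \<and> (\<exists>X :: 'a set. G \<cong> free_group X)"


section \<open>Free products and generalized free products\<close>

definition free_product_rels ::
    "'i set \<Rightarrow> ('i \<Rightarrow> ('b, 'n) monoid_scheme) \<Rightarrow> (('i \<times> 'b) list \<times> ('i \<times> 'b) list) set" where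
  "free_product_rels I B =
     {([(i, x), (i, y)], [(i, x \<otimes>\<^bsub>B i\<^esub> y)]) | i x y. i \<in> I \<and> x \<in> carrier (B i) \<and> y \<in> carrier (B i)}
     \<union> {([(i, \<one>\<^bsub>B i\<^esub>)], []) | i. i \<in> I}"

definition free_product ::
    "'i set \<Rightarrow> ('i \<Rightarrow> ('b, 'n) monoid_scheme) \<Rightarrow> ('i \<times> 'b) list set monoid" where
  "free_product I B = word_monoid (SIGMA i:I. carrier (B i)) (free_product_rels I B)"

definition free_product_inj ::
    "'i set \<Rightarrow> ('i \<Rightarrow> ('b, 'n) monoid_scheme) \<Rightarrow> 'i \<Rightarrow> 'b \<Rightarrow> ('i \<times> 'b) list set" where
  "free_product_inj I B i x = word_cong (free_product_rels I B) `` {[(i, x)]}"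

lemma group_free_product:
  assumes "\<And>i. i \<in> I \<Longrightarrow> group (B i)"
  shows "group (free_product I B)"
  unfolding free_product_def
proof (rule group_word_monoid)
  fix p assume "p \<in> (SIGMA i:I. carrier (B i))"
  then obtain i x where p: "p = (i, x)" "i \<in> I" "x \<in> carrier (B i)" by blast
  interpret group "B i" using assms p by blast
  have "([(i, inv\<^bsub>B i\<^esub> x), (i, x)], [(i, \<one>\<^bsub>B i\<^esub>)]) \<in> word_cong (free_product_rels I B)"
    using p by (intro word_cong.rel) (force simp: free_product_rels_def)
  moreover have "([(i, \<one>\<^bsub>B i\<^esub>)], []) \<in> word_cong (free_product_rels I B)"
    using p by (intro word_cong.rel) (auto simp: free_product_rels_def)
  ultimately show "\<exists>q\<in>(SIGMA i:I. carrier (B i)). ([q, p], []) \<in> word_cong (free_product_rels I B)"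
    using p by (intro bexI[of _ "(i, inv\<^bsub>B i\<^esub> x)"]) (auto intro: word_cong.trans)
qed

lemma free_product_inj_hom:
  assumes "i \<in> I"
  shows "free_product_inj I B i \<in> hom (B i) (free_product I B)"
proof (rule homI)
  fix x y assume "x \<in> carrier (B i)" "y \<in> carrier (B i)"
  with assms have "([(i, x), (i, y)], [(i, x \<otimes>\<^bsub>B i\<^esub> y)]) \<in> word_cong (free_product_rels I B)"
    by (intro word_cong.rel) (auto simp: free_product_rels_def)
  then show "free_product_inj I B i (x \<otimes>\<^bsub>B i\<^esub> y)
      = free_product_inj I B i x \<otimes>\<^bsub>free_product I B\<^esub> free_product_inj I B i y"
    by (simp add: free_product_inj_def free_product_def word_monoid_mult_class
        word_cong_class_eq_iff word_cong.sym)
qed (use assms in \<open>auto simp: free_product_inj_def free_product_def word_monoid_def intro!: quotientI\<close>)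

definition normal_closure :: "('a, 'm) monoid_scheme \<Rightarrow> 'a set \<Rightarrow> 'a set" where
  "normal_closure G S = \<Inter>{N. N \<lhd> G \<and> S \<subseteq> N}"

definition generalized_free_product ::
    "'i set \<Rightarrow> ('i \<Rightarrow> ('b, 'n) monoid_scheme) \<Rightarrow> 'c set \<Rightarrow> ('i \<Rightarrow> 'c \<Rightarrow> 'b)
      \<Rightarrow> ('i \<times> 'b) list set set monoid" where
  "generalized_free_product I B C \<theta> =
     free_product I B Mod
       normal_closure (free_product I B)
         {free_product_inj I B i (\<theta> i c)
            \<otimes>\<^bsub>free_product I B\<^esub> inv\<^bsub>free_product I B\<^esub> (free_product_inj I B j (\<theta> j c))
          | i j c. i \<in> I \<and> j \<in> I \<and> c \<in> C}"


section \<open>Group-theoretic properties\<close>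

primrec lower_central_series :: "('a, 'm) monoid_scheme \<Rightarrow> nat \<Rightarrow> 'a set" where
  "lower_central_series G 0 = carrier G"
| "lower_central_series G (Suc n) =
     generate G {x \<otimes>\<^bsub>G\<^esub> y \<otimes>\<^bsub>G\<^esub> inv\<^bsub>G\<^esub> x \<otimes>\<^bsub>G\<^esub> inv\<^bsub>G\<^esub> y | x y.
                   x \<in> lower_central_series G n \<and> y \<in> carrier G}"

definition nilpotent_group :: "('a, 'm) monoid_scheme \<Rightarrow> bool" where
  "nilpotent_group G \<longleftrightarrow> group G \<and> (\<exists>n. lower_central_series G n = {\<one>\<^bsub>G\<^esub>})"

definition torsion_free_group :: "('a, 'm) monoid_scheme \<Rightarrow> bool" where
  "torsion_free_group G \<longleftrightarrow>
     group G \<and> (\<forall>x\<in>carrier G. \<forall>n::nat. n > 0 \<longrightarrow> x [^]\<^bsub>G\<^esub> n = \<one>\<^bsub>G\<^esub> \<longrightarrow> x = \<one>\<^bsub>G\<^esub>)"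

text \<open>
  \<open>G\<close> is an extension of \<open>N\<close> by \<open>Q\<close>.  The library's \<^const>\<open>short_exact_sequence\<close> requires all groups
  to have the same carrier type; the lemma below shows that the two notions then agree.
\<close>

definition is_extension ::
    "('g, 'k) monoid_scheme \<Rightarrow> ('n, 'l) monoid_scheme \<Rightarrow> ('q, 'm) monoid_scheme \<Rightarrow> bool" where
  "is_extension G N Q \<longleftrightarrow>
     group G \<and> group N \<and> group Q \<and>
     (\<exists>f g. f \<in> mon N G \<and> g \<in> epi G Q \<and> f ` carrier N = kernel G Q g)"

lemma is_extension_iff_short_exact_sequence:
  fixes G N Q :: "'a monoid"
  shows "is_extension G N Q \<longleftrightarrow> (\<exists>f g. short_exact_sequence Q G N g f)"
  unfolding is_extension_def short_exact_sequence_iff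
  by (auto simp: group_hom_def group_hom_axioms_def mon_def epi_def) metis

text \<open>
  Up to isomorphism every homomorphic image of \<open>G\<close> is a quotient \<open>G Mod N\<close>, so it is enough that the
  solvable group ranges over groups whose carrier consists of sets of elements of \<open>G\<close>.
\<close>

definition residually_solvable :: "('a, 'm) monoid_scheme \<Rightarrow> bool" where
  "residually_solvable G \<longleftrightarrow>
     group G \<and>
     (\<forall>g\<in>carrier G. g \<noteq> \<one>\<^bsub>G\<^esub> \<longrightarrow>
        (\<exists>(H :: 'a set monoid) h. group H \<and> solvable H \<and> h \<in> epi G H \<and> h g \<noteq> \<one>\<^bsub>H\<^esub>))"

end

theory Submission
  imports Defs "HOL-Algebra.Left_Coset"
begin

text \<open>
  Folding all copies of \<open>A\<close> together gives a homomorphism \<open>G \<rightarrow> A\<close>.  Fix an index \<open>i0\<close>.  The elements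
  \<open>y i (aC) = \<iota> i a (\<iota> i0 a)\<inverse>\<close> with \<open>i \<noteq> i0\<close>, \<open>a \<notin> C\<close> lie in its kernel, and conjugation by \<open>\<iota> i0 b\<close> sends
  \<open>y i (aC)\<close> to \<open>(y i (bC))\<inverse> y i (baC)\<close>.  This formula defines an action of \<open>A\<close> on the free group \<open>F\<close> on
  the symbols \<open>y i (aC)\<close>, and \<open>\<iota> i a \<mapsto> (y i (aC), a)\<close> is an isomorphism from \<open>G\<close> onto the resulting
  semidirect product; hence the kernel is free.  Residual solvability then follows because the
  derived series of a free group intersects trivially.
\<close>

section \<open>Homomorphisms out of presented groups\<close>

text \<open>The conjugation formula is forced. Write y(a) for \<open>\<iota> i a\<close> times the
  inverse of \<open>\<iota> i0 a\<close>. Conjugating y(a) by \<open>\<iota> i0 b\<close> and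
  inserting the inverse of \<open>\<iota> i b\<close> and \<open>\<iota> i b\<close> itself in front
  of \<open>\<iota> i a\<close> gives y(b)^-1 y(ba). The obstacle is to show that the y(a) satisfy
  no relation in \<open>G\<close>. Normal forms in the amalgam are avoided: the action is built on
  an abstract free group, where freeness holds by construction, and the universal property of
  \<open>G\<close> supplies a homomorphism into the semidirect product. A relation among the y(a)
  would show up there. Residual solvability passes from the kernel to \<open>G\<close> because the
  quotient is solvable: a fixed term of the derived series of \<open>G\<close> already lies in the
  kernel. For the free group itself, a reduced word of length n > 0 lies outside the n-th derived
  term, as shown by counting how often its path traverses one edge of a Cayley graph.\<close>

lemma hom_eq_on_generate:
  assumes "group G" "group H" "h \<in> hom G H" "k \<in> hom G H" "S \<subseteq> carrier G"
    and eq: "\<And>s. s \<in> S \<Longrightarrow> h s = k s" and "x \<in> generate G S"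
  shows "h x = k x"
proof -
  interpret h: group_hom G H h using assms by (simp add: group_hom_def group_hom_axioms_def)
  interpret k: group_hom G H k using assms by (simp add: group_hom_def group_hom_axioms_def)
  have *: "x \<in> carrier G \<and> h x = k x" using \<open>x \<in> generate G S\<close>
  proof induction
    case (incl s) then show ?case using eq assms(5) by auto
  next
    case (inv s) then show ?case using eq assms(5) by (metis h.G.inv_closed h.hom_inv k.hom_inv subsetD)
  qed (use h.hom_mult k.hom_mult in auto)
  then show ?thesis ..
qed

definition eval_word :: "('h, 'm) monoid_scheme \<Rightarrow> ('a \<Rightarrow> 'h) \<Rightarrow> 'a list \<Rightarrow> 'h" where
  "eval_word H f w = foldr (\<lambda>s a. f s \<otimes>\<^bsub>H\<^esub> a) w \<one>\<^bsub>H\<^esub>"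

lemma eval_word_simps [simp]:
  "eval_word H f [] = \<one>\<^bsub>H\<^esub>" "eval_word H f (s # w) = f s \<otimes>\<^bsub>H\<^esub> eval_word H f w"
  by (simp_all add: eval_word_def)

lemma (in group) eval_word_closed:
  assumes "\<And>s. f s \<in> carrier G" shows "eval_word G f w \<in> carrier G"
  by (induction w) (auto simp: assms)

lemma (in group) eval_word_append:
  assumes "\<And>s. f s \<in> carrier G"
  shows "eval_word G f (u @ v) = eval_word G f u \<otimes> eval_word G f v"
  by (induction u) (auto simp: assms eval_word_closed m_assoc)

lemma (in group) eval_word_cong:
  assumes "\<And>s. f s \<in> carrier G" "\<And>u v. (u, v) \<in> R \<Longrightarrow> eval_word G f u = eval_word G f v"
    and "(u, v) \<in> word_cong R"
  shows "eval_word G f u = eval_word G f v"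
  using assms(3) by induction (auto simp: assms(1,2) eval_word_append)

lemma eval_word_restrict:
  "w \<in> lists S \<Longrightarrow> (\<And>s. s \<in> S \<Longrightarrow> f s = g s) \<Longrightarrow> eval_word H f w = eval_word H g w"
  by (induction w) auto

lemma word_class_in_carrier: "w \<in> lists S \<Longrightarrow> word_cong R `` {w} \<in> carrier (word_monoid S R)"
  by (simp add: word_monoid_def quotientI)

lemma word_monoid_carrierE:
  assumes "U \<in> carrier (word_monoid S R)"
  obtains u where "u \<in> lists S" "U = word_cong R `` {u}"
  using assms by (auto simp: word_monoid_def quotient_def)

text \<open>Evaluating words in \<open>H\<close> respects the relations and concatenation, hence is
  constant on classes. Any representative may therefore be chosen to define the map.\<close>

lemma word_monoid_hom_exists:
  assumes "group H" and f: "\<And>s. s \<in> S \<Longrightarrow> f s \<in> carrier H"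
    and R: "\<And>u v. (u, v) \<in> R \<Longrightarrow> u \<in> lists S \<and> v \<in> lists S \<and> eval_word H f u = eval_word H f v"
  shows "\<exists>h\<in>hom (word_monoid S R) H. \<forall>s\<in>S. h (word_cong R `` {[s]}) = f s"
proof -
  interpret group H by fact
  \<comment> \<open>The default value outside \<open>S\<close> keeps every letter inside the
    carrier, as the evaluation lemmas require; \<open>word_cong\<close> is a relation on all words,
    not only on those over \<open>S\<close>.\<close>
  define f' where "f' s = (if s \<in> S then f s else \<one>\<^bsub>H\<^esub>)" for s
  have f': "f' s \<in> carrier H" for s using f by (simp add: f'_def)
  have R': "eval_word H f' u = eval_word H f' v" if "(u, v) \<in> R" for u v
  proof -
    have "eval_word H f w = eval_word H f' w" if "w \<in> lists S" for w
      by (rule eval_word_restrict[OF that]) (simp add: f'_def)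
    then show ?thesis using R[OF that] by metis
  qed
  define h where "h U = eval_word H f' (SOME u. u \<in> U)" for U
  have h: "h (word_cong R `` {u}) = eval_word H f' u" for u
  proof -
    have "(SOME v. v \<in> word_cong R `` {u}) \<in> word_cong R `` {u}"
      by (rule someI[of _ u]) (simp add: word_cong.refl)
    then show ?thesis unfolding h_def
      using eval_word_cong[OF f' R'] by force
  qed
  show ?thesis
  proof (intro bexI[of _ h] ballI homI)
    fix U V assume "U \<in> carrier (word_monoid S R)" "V \<in> carrier (word_monoid S R)"
    then obtain u v where "U = word_cong R `` {u}" "V = word_cong R `` {v}"
      by (meson word_monoid_carrierE)
    then show "h (U \<otimes>\<^bsub>word_monoid S R\<^esub> V) = h U \<otimes>\<^bsub>H\<^esub> h V"
      by (simp add: word_monoid_mult_class h eval_word_append f')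
  next
    fix s assume "s \<in> S"
    then show "h (word_cong R `` {[s]}) = f s" using f by (simp add: h f'_def)
  next
    fix U assume "U \<in> carrier (word_monoid S R)"
    then obtain u where "U = word_cong R `` {u}" by (meson word_monoid_carrierE)
    then show "h U \<in> carrier H" by (simp add: h eval_word_closed f')
  qed
qed

lemma word_class_in_generate:
  assumes "group (word_monoid S R)" "w \<in> lists S"
  shows "word_cong R `` {w} \<in> generate (word_monoid S R) ((\<lambda>s. word_cong R `` {[s]}) ` S)"
  using assms(2)
proof (induction w)
  case Nil
  then show ?case using generate.one[of "word_monoid S R"] by (simp add: word_monoid_def)
next
  case (Cons s w)
  then have "word_cong R `` {[s]} \<otimes>\<^bsub>word_monoid S R\<^esub> word_cong R `` {w}
      \<in> generate (word_monoid S R) ((\<lambda>s. word_cong R `` {[s]}) ` S)"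
    by (intro generate.eng) (auto intro: generate.incl)
  then show ?case by (simp add: word_monoid_mult_class)
qed

lemma word_monoid_generate:
  assumes "group (word_monoid S R)"
  shows "generate (word_monoid S R) ((\<lambda>s. word_cong R `` {[s]}) ` S) = carrier (word_monoid S R)"
proof
  show "generate (word_monoid S R) ((\<lambda>s. word_cong R `` {[s]}) ` S) \<subseteq> carrier (word_monoid S R)"
    by (rule group.generate_incl[OF assms]) (auto simp: word_class_in_carrier)
  show "carrier (word_monoid S R) \<subseteq> generate (word_monoid S R) ((\<lambda>s. word_cong R `` {[s]}) ` S)"
    by (auto elim!: word_monoid_carrierE intro: word_class_in_generate[OF assms])
qed


section \<open>Free groups\<close>

definition free_gen :: "'x set \<Rightarrow> 'x \<Rightarrow> ('x \<times> bool) list set" where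
  "free_gen X x = word_cong (free_group_rels X) `` {[(x, True)]}"

lemma free_gen_closed: "x \<in> X \<Longrightarrow> free_gen X x \<in> carrier (free_group X)"
  by (auto simp: free_gen_def free_group_def intro: word_class_in_carrier)

lemma one_free_group: "\<one>\<^bsub>free_group X\<^esub> = word_cong (free_group_rels X) `` {[]}"
  by (simp add: free_group_def word_monoid_def)

text \<open>The presentation has separate letters for inverses. This identifies them with group
  inverses, so that the elements \<open>free_gen X x\<close> alone generate the group.\<close>

lemma word_class_inverse_letter:
  assumes "x \<in> X"
  shows "word_cong (free_group_rels X) `` {[(x, False)]} = inv\<^bsub>free_group X\<^esub> (free_gen X x)"
proof -
  interpret group "free_group X" by (rule group_free_group)
  have "([(x, False), (x, True)], []) \<in> word_cong (free_group_rels X)"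
    using assms by (intro word_cong.rel) (force simp: free_group_rels_def)
  then have "word_cong (free_group_rels X) `` {[(x, False)]} \<otimes>\<^bsub>free_group X\<^esub> free_gen X x = \<one>\<^bsub>free_group X\<^esub>"
    unfolding free_gen_def one_free_group by (simp add: free_group_def word_monoid_mult_class word_cong_class_eq_iff)
  then show ?thesis
    using assms free_gen_closed[OF assms]
    by (intro inv_equality[symmetric]) (auto simp: free_group_def intro!: word_class_in_carrier)
qed

lemma free_group_hom_exists:
  assumes "group H" and f: "\<And>x. x \<in> X \<Longrightarrow> f x \<in> carrier H"
  shows "\<exists>h\<in>hom (free_group X) H. \<forall>x\<in>X. h (free_gen X x) = f x"
proof -
  interpret group H by fact
  define f' where "f' = (\<lambda>(x, b). if b then f x else inv\<^bsub>H\<^esub> f x)"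
  have "\<exists>h\<in>hom (word_monoid (X \<times> UNIV) (free_group_rels X)) H.
      \<forall>s\<in>X \<times> UNIV. h (word_cong (free_group_rels X) `` {[s]}) = f' s"
  proof (rule word_monoid_hom_exists[OF \<open>group H\<close>])
    fix u v assume "(u, v) \<in> free_group_rels X"
    then obtain x b where "x \<in> X" "u = [(x, b), (x, \<not> b)]" "v = []"
      by (auto simp: free_group_rels_def)
    then show "u \<in> lists (X \<times> UNIV) \<and> v \<in> lists (X \<times> UNIV) \<and> eval_word H f' u = eval_word H f' v"
      using f by (simp add: f'_def)
  qed (use f in \<open>auto simp: f'_def\<close>)
  then obtain h where "h \<in> hom (free_group X) H"
    and "\<And>s. s \<in> X \<times> UNIV \<Longrightarrow> h (word_cong (free_group_rels X) `` {[s]}) = f' s"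
    unfolding free_group_def by blast
  then show ?thesis by (intro bexI[of _ h]) (auto simp: free_gen_def f'_def)
qed

lemma free_group_generate: "generate (free_group X) (free_gen X ` X) = carrier (free_group X)"
proof
  interpret group "free_group X" by (rule group_free_group)
  have gens: "free_gen X ` X \<subseteq> carrier (free_group X)" by (auto simp: free_gen_closed)
  then show "generate (free_group X) (free_gen X ` X) \<subseteq> carrier (free_group X)"
    by (rule generate_incl)
  have "(\<lambda>s. word_cong (free_group_rels X) `` {[s]}) ` (X \<times> UNIV) \<subseteq> generate (free_group X) (free_gen X ` X)"
  proof clarify
    fix x b assume "x \<in> X"
    then show "word_cong (free_group_rels X) `` {[(x, b)]} \<in> generate (free_group X) (free_gen X ` X)"
      by (cases b) (auto simp: word_class_inverse_letter generate.inv free_gen_def[symmetric] intro: generate.incl)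
  qed
  then have "generate (free_group X) ((\<lambda>s. word_cong (free_group_rels X) `` {[s]}) ` (X \<times> UNIV))
      \<subseteq> generate (free_group X) (free_gen X ` X)"
    by (intro generate_subgroup_incl generate_is_subgroup gens)
  then show "carrier (free_group X) \<subseteq> generate (free_group X) (free_gen X ` X)"
    using word_monoid_generate group_free_group unfolding free_group_def by metis
qed

lemma free_group_hom_eq:
  assumes "group H" "h \<in> hom (free_group X) H" "k \<in> hom (free_group X) H"
    and "\<And>x. x \<in> X \<Longrightarrow> h (free_gen X x) = k (free_gen X x)" and "u \<in> carrier (free_group X)"
  shows "h u = k u"
  by (rule hom_eq_on_generate[OF group_free_group assms(1-3), of "free_gen X ` X"])
    (use assms in \<open>auto simp: free_gen_closed free_group_generate\<close>)

text \<open>Distinct generators are separated by the homomorphism to the integers that sends one of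
  them to 1 and all others to 0.\<close>

lemma inj_on_free_gen: "inj_on (free_gen X) X"
proof (rule inj_onI, rule ccontr)
  fix x y assume xy: "x \<in> X" "y \<in> X" "free_gen X x = free_gen X y" "x \<noteq> y"
  obtain h where "\<And>z. z \<in> X \<Longrightarrow> h (free_gen X z) = (if z = x then 1 else (0::int))"
    using free_group_hom_exists[of integer_group X "\<lambda>z. if z = x then 1 else 0"] by auto
  with xy show False by (metis zero_neq_one)
qed

text \<open>The basis \<open>X\<close> may have a type unrelated to that of \<open>N\<close>,
  whereas \<open>is_free_group\<close> wants one in the carrier type. The images of the generators
  under the inverse isomorphism form a copy of \<open>X\<close> inside \<open>N\<close>, and the
  bijection of bases extends to the free groups.\<close>

lemma is_free_groupI:
  assumes "group N" "h \<in> iso N (free_group X)"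
  shows "is_free_group N"
proof -
  interpret F: group "free_group X" by (rule group_free_group)
  interpret N: group N by fact
  obtain k where k: "k \<in> iso (free_group X) N"
    using assms N.iso_set_sym by blast
  define g where "g x = k (free_gen X x)" for x
  have k': "k \<in> hom (free_group X) N" "bij_betw k (carrier (free_group X)) (carrier N)"
    using k by (auto simp: iso_def)
  have inj: "inj_on g X"
    unfolding g_def
    by (intro inj_onI) (metis free_gen_closed inj_on_free_gen bij_betw_def k'(2) inj_onD)
  interpret F': group "free_group (g ` X)" by (rule group_free_group)
  obtain p where p: "p \<in> hom (free_group X) (free_group (g ` X))"
    and pg: "\<And>x. x \<in> X \<Longrightarrow> p (free_gen X x) = free_gen (g ` X) (g x)"
    using free_group_hom_exists[of "free_group (g ` X)" X "\<lambda>x. free_gen (g ` X) (g x)"]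
    by (auto simp: free_gen_closed)
  obtain q where q: "q \<in> hom (free_group (g ` X)) (free_group X)"
    and qg: "\<And>y. y \<in> g ` X \<Longrightarrow> q (free_gen (g ` X) y) = free_gen X (inv_into X g y)"
    using free_group_hom_exists[of "free_group X" "g ` X" "\<lambda>y. free_gen X (inv_into X g y)"]
    by (auto simp: free_gen_closed inv_into_into)
  have "q (p u) = u" if "u \<in> carrier (free_group X)" for u
    using free_group_hom_eq[OF F.group_axioms hom_compose[OF p q], of id, OF _ _ that]
    by (auto simp: pg qg inj hom_def)
  moreover have "p (q (free_gen (g ` X) y)) = free_gen (g ` X) y" if "y \<in> g ` X" for y
    using that inj by (auto simp: pg qg)
  then have "p (q v) = v" if "v \<in> carrier (free_group (g ` X))" for v
    using free_group_hom_eq[OF F'.group_axioms hom_compose[OF q p], of id, OF _ _ that]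
    by (auto simp: hom_def)
  ultimately have "bij_betw p (carrier (free_group X)) (carrier (free_group (g ` X)))"
    using p q by (intro bij_betw_byWitness[where f' = q]) (auto simp: hom_def)
  then have "free_group X \<cong> free_group (g ` X)" using p by (auto simp: is_iso_def iso_def)
  then have "N \<cong> free_group (g ` X)" using assms(2) iso_trans unfolding is_iso_def by blast
  then show ?thesis using \<open>group N\<close> by (auto simp: is_free_group_def)
qed


section \<open>The derived series of a free group\<close>

lemma (in group) exp_of_derived_is_normal: "(derived G ^^ n) (carrier G) \<lhd> G"
  by (induction n) (auto intro: derived_is_normal normal_self)

abbreviation flip_letter :: "'x \<times> bool \<Rightarrow> 'x \<times> bool" where
  "flip_letter s \<equiv> (fst s, \<not> snd s)"

text \<open>
  If \<open>P\<close> is the set of words representing elements of a normal subgroup \<open>N\<close>, this is the signed number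
  of times the path \<open>w\<close>, started at the vertex \<open>p\<close> of the Cayley graph of the quotient by \<open>N\<close>,
  traverses the edge labelled \<open>l\<close> that leaves the identity vertex.
\<close>

fun crossings :: "(('x \<times> bool) list \<Rightarrow> bool) \<Rightarrow> 'x \<times> bool \<Rightarrow> ('x \<times> bool) list \<Rightarrow> ('x \<times> bool) list \<Rightarrow> int"
where
  "crossings P l p [] = 0"
| "crossings P l p (s # w) =
     of_bool (s = l \<and> P p) - of_bool (s = flip_letter l \<and> P (p @ [s])) + crossings P l (p @ [s]) w"

lemma crossings_append: "crossings P l p (u @ v) = crossings P l p u + crossings P l (p @ u) v"
  by (induction u arbitrary: p) auto

text \<open>Used for two kinds of prefixes that end at the same vertex: congruent words, and a word
  representing an element of \<open>N\<close> compared with the empty word.\<close>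

lemma crossings_prefix_cong:
  assumes "\<And>q. q \<in> lists S \<Longrightarrow> P (p @ q) = P (p' @ q)" "w \<in> lists S"
  shows "crossings P l p w = crossings P l p' w"
  using assms(2,1)
proof (induction w arbitrary: p p')
  case (Cons s w)
  have "crossings P l (p @ [s]) w = crossings P l (p' @ [s]) w"
    using Cons.prems Cons.hyps by (intro Cons.IH) (auto dest: Cons.prems[of "s # _"])
  then show ?case using Cons.prems[of "[]"] Cons.prems[of "[s]"] Cons.hyps by simp
qed auto

text \<open>A negative sum has a negative term, and such a term arises only when the path runs
  backwards along the edge \<open>l\<close> and arrives at a vertex satisfying
  \<open>P\<close>.\<close>

lemma crossings_neg:
  "crossings P l p w < 0 \<Longrightarrow> \<exists>u v. w = u @ [flip_letter l] @ v \<and> P (p @ u @ [flip_letter l])"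
proof (induction w arbitrary: p)
  case (Cons s w)
  show ?case
  proof (cases "s = flip_letter l \<and> P (p @ [s])")
    case True
    then show ?thesis by (intro exI[of _ "[]"] exI[of _ w]) auto
  next
    case False
    then have "crossings P l (p @ [s]) w < 0" using Cons.prems by (auto simp: of_bool_def split: if_splits)
    then obtain u v where "w = u @ [flip_letter l] @ v" "P ((p @ [s]) @ u @ [flip_letter l])"
      using Cons.IH by blast
    then show ?thesis by (intro exI[of _ "s # u"] exI[of _ v]) auto
  qed
qed auto

context
  fixes X :: "'x set" and N :: "('x \<times> bool) list set set"
  assumes N: "N \<lhd> free_group X"
begin

private abbreviation (input) cls :: "('x \<times> bool) list \<Rightarrow> ('x \<times> bool) list set" where
  "cls w \<equiv> word_cong (free_group_rels X) `` {w}"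

text \<open>Traversing an edge and going straight back contributes opposite amounts, so free
  cancellation leaves the count unchanged.\<close>

lemma crossings_word_cong:
  assumes "(u, v) \<in> word_cong (free_group_rels X)"
  shows "crossings (\<lambda>w. cls w \<in> N) l p u = crossings (\<lambda>w. cls w \<in> N) l p v"
  using assms
proof (induction arbitrary: p)
  case (rel u v)
  then obtain x b where x: "x \<in> X" "u = [(x, b), (x, \<not> b)]" "v = []"
    by (auto simp: free_group_rels_def)
  have "(p @ u, p @ v) \<in> word_cong (free_group_rels X)"
    by (intro word_cong.append word_cong.refl word_cong.rel rel)
  then have "cls (p @ u) = cls p" using x by (simp add: word_cong_class_eq_iff)
  then show ?case using x by (cases l) auto
next
  case (append u v u' v')
  have "cls ((p @ u) @ q) = cls ((p @ v) @ q)" for q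
    using append.hyps by (simp only: word_cong_class_eq_iff append_assoc) (intro word_cong.append word_cong.refl)
  then have "crossings (\<lambda>w. cls w \<in> N) l (p @ u) u' = crossings (\<lambda>w. cls w \<in> N) l (p @ v) u'"
    by (intro crossings_prefix_cong[where S = UNIV]) auto
  then show ?case using append.IH by (simp add: crossings_append)
qed auto

text \<open>Elements of \<open>N\<close> are loops at the identity vertex, and counts of
  concatenated loops add up. The count is thus a homomorphism from \<open>N\<close> to the integers,
  which kills commutators of elements of \<open>N\<close>.\<close>

lemma crossings_derived:
  assumes "cls w \<in> derived (free_group X) N"
  shows "crossings (\<lambda>w. cls w \<in> N) l [] w = 0"
proof -
  interpret F: group "free_group X" by (rule group_free_group)
  interpret N: normal N "free_group X" by (rule N)
  interpret NG: group "free_group X\<lparr>carrier := N\<rparr>" by (rule N.subgroup_is_group[OF F.group_axioms])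
  define c where "c U = crossings (\<lambda>w. cls w \<in> N) l [] (SOME u. u \<in> U)" for U
  have c: "c (cls u) = crossings (\<lambda>w. cls w \<in> N) l [] u" for u
  proof -
    have "(SOME v. v \<in> cls u) \<in> cls u" by (rule someI[of _ u]) (simp add: word_cong.refl)
    then show ?thesis unfolding c_def by (intro crossings_word_cong) (simp add: word_cong.sym)
  qed
  have "c \<in> hom (free_group X\<lparr>carrier := N\<rparr>) integer_group"
  proof (rule homI)
    fix U V assume "U \<in> carrier (free_group X\<lparr>carrier := N\<rparr>)" "V \<in> carrier (free_group X\<lparr>carrier := N\<rparr>)"
    then have UV: "U \<in> N" "V \<in> N" by auto
    then obtain u v where u: "U = cls u" and v: "v \<in> lists (X \<times> UNIV)" "V = cls v"
      using N.subset unfolding free_group_def by (meson subsetD word_monoid_carrierE)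
    \<comment> \<open>The path \<open>u\<close> ends at the identity vertex, since its class lies in
      \<open>N\<close>; after it, \<open>v\<close> meets the same vertices as when started
      there.\<close>
    have "crossings (\<lambda>w. cls w \<in> N) l u v = crossings (\<lambda>w. cls w \<in> N) l [] v"
    proof (rule crossings_prefix_cong[OF _ v(1)])
      fix q assume q: "q \<in> lists (X \<times> (UNIV :: bool set))"
      then have "cls q \<in> carrier (free_group X)" by (simp add: free_group_def word_class_in_carrier)
      moreover have "cls (u @ q) = U \<otimes>\<^bsub>free_group X\<^esub> cls q"
        by (simp add: u free_group_def word_monoid_mult_class)
      ultimately show "(cls (u @ q) \<in> N) = (cls ([] @ q) \<in> N)"
        using UV(1) by (metis F.inv_closed F.inv_solve_left N.m_closed N.m_inv_closed N.mem_carrier append_Nil)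
    qed
    then have "c (cls (u @ v)) = c U + c V" by (simp only: u v c crossings_append append_Nil)
    then show "c (U \<otimes>\<^bsub>free_group X\<lparr>carrier := N\<rparr>\<^esub> V) = c U \<otimes>\<^bsub>integer_group\<^esub> c V"
      by (simp add: u v free_group_def word_monoid_mult_class)
  qed simp
  then interpret c: group_hom "free_group X\<lparr>carrier := N\<rparr>" integer_group c
    by (simp add: group_hom_def group_hom_axioms_def NG.group_axioms)
  have "comm_group integer_group" by (rule abelian_integer_group)
  then have "derived integer_group (c ` N) = {0}"
    using comm_group.derived_eq_singleton[of integer_group "c ` N"] by simp
  then have "c ` derived (free_group X\<lparr>carrier := N\<rparr>) N = {0}"
    using c.derived_img[of N] by simp
  moreover have "derived (free_group X\<lparr>carrier := N\<rparr>) N = derived (free_group X) N"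
    using F.derived_consistent[OF subset_refl N.is_subgroup] by simp
  ultimately show ?thesis using assms by (auto simp flip: c)
qed

end

section \<open>Reduced words and the intersection of the derived series\<close>

definition reduced_word :: "('x \<times> bool) list \<Rightarrow> bool" where
  "reduced_word w \<longleftrightarrow> (\<nexists>u s v. w = u @ [s, flip_letter s] @ v)"

text \<open>
  If a reduced word lies in \<open>[N, N]\<close>, the path it describes must undo the crossing of its first edge;
  the segment in between is a shorter reduced word and represents an element of \<open>N\<close>.
\<close>

lemma reduced_word_not_in_derived:
  assumes "w \<in> lists (X \<times> UNIV)" "reduced_word w" "w \<noteq> []" "length w \<le> n"
  shows "word_cong (free_group_rels X) `` {w}
    \<notin> (derived (free_group X) ^^ n) (carrier (free_group X))"
  using assms
proof (induction n arbitrary: w)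
  case (Suc n)
  interpret F: group "free_group X" by (rule group_free_group)
  define N where "N = (derived (free_group X) ^^ n) (carrier (free_group X))"
  interpret N: normal N "free_group X" unfolding N_def by (rule F.exp_of_derived_is_normal)
  have P_Nil: "word_cong (free_group_rels X) `` {[]} \<in> N"
    using N.one_closed by (simp add: one_free_group)
  obtain l w' where w: "w = l # w'" using Suc.prems by (cases w) auto
  show ?case
  proof
    assume "word_cong (free_group_rels X) `` {w} \<in> (derived (free_group X) ^^ Suc n) (carrier (free_group X))"
    then have "crossings (\<lambda>w. word_cong (free_group_rels X) `` {w} \<in> N) l [] w = 0"
      by (intro crossings_derived[OF N.normal_axioms]) (simp add: N_def)
    \<comment> \<open>The first edge leaves the identity vertex and contributes exactly 1, as a
      letter differs from its flip; the rest of the path must contribute -1.\<close>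
    then have "crossings (\<lambda>w. word_cong (free_group_rels X) `` {w} \<in> N) l [l] w' < 0"
      using P_Nil by (cases l) (simp add: w)
    then obtain u v where w': "w' = u @ [flip_letter l] @ v"
      and inN: "word_cong (free_group_rels X) `` {[l] @ u @ [flip_letter l]} \<in> N"
      using crossings_neg by blast
    have "u \<noteq> []"
    proof
      assume "u = []"
      then have "w = [] @ [l, flip_letter l] @ v" by (simp add: w w')
      then show False using Suc.prems(2) unfolding reduced_word_def by blast
    qed
    moreover have "reduced_word u"
      unfolding reduced_word_def
    proof clarify
      fix a s b assume "u = a @ [s, flip_letter s] @ b"
      then have "w = (l # a) @ [s, flip_letter s] @ (b @ [flip_letter l] @ v)" by (simp add: w w')
      then show False using Suc.prems(2) unfolding reduced_word_def by blast
    qed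
    \<comment> \<open>Besides \<open>u\<close>, the word \<open>w\<close> contains at least the two
      letters \<open>l\<close> and \<open>flip_letter l\<close>, so \<open>u\<close> satisfies the
      length bound of the induction hypothesis.\<close>
    ultimately have notN: "word_cong (free_group_rels X) `` {u} \<notin> N"
      unfolding N_def using Suc.prems w w' by (intro Suc.IH) auto
    have carr: "word_cong (free_group_rels X) `` {[l]} \<in> carrier (free_group X)"
      "word_cong (free_group_rels X) `` {u} \<in> carrier (free_group X)"
      "word_cong (free_group_rels X) `` {[flip_letter l]} \<in> carrier (free_group X)"
      using Suc.prems(1) by (auto simp: w w' free_group_def intro!: word_class_in_carrier)
    define a where "a = word_cong (free_group_rels X) `` {[l]}"
    define b where "b = word_cong (free_group_rels X) `` {u}"
    define a' where "a' = word_cong (free_group_rels X) `` {[flip_letter l]}"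
    have "([l, flip_letter l], []) \<in> free_group_rels X"
      using Suc.prems(1) by (cases l) (auto simp: w free_group_rels_def)
    then have "a \<otimes>\<^bsub>free_group X\<^esub> a' = \<one>\<^bsub>free_group X\<^esub>"
      unfolding a_def a'_def one_free_group
      by (simp add: free_group_def word_monoid_mult_class word_cong_class_eq_iff word_cong.rel)
    then have a': "a' = inv\<^bsub>free_group X\<^esub> a"
      using carr F.inv_equality F.inv_inv unfolding a_def a'_def by metis
    \<comment> \<open>Here normality of \<open>N\<close> enters: the segment together with its two
      enclosing letters is a conjugate of \<open>b\<close>, so conjugating back puts
      \<open>b\<close> into \<open>N\<close>.\<close>
    have "a \<otimes>\<^bsub>free_group X\<^esub> b \<otimes>\<^bsub>free_group X\<^esub> a' \<in> N"
      using inN by (simp add: a_def b_def a'_def free_group_def word_monoid_mult_class)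
    then have "inv\<^bsub>free_group X\<^esub> a \<otimes>\<^bsub>free_group X\<^esub> (a \<otimes>\<^bsub>free_group X\<^esub> b \<otimes>\<^bsub>free_group X\<^esub> inv\<^bsub>free_group X\<^esub> a) \<otimes>\<^bsub>free_group X\<^esub> a \<in> N"
      using carr(1) unfolding a' by (intro N.inv_op_closed1) (auto simp: a_def)
    moreover have "inv\<^bsub>free_group X\<^esub> a \<otimes>\<^bsub>free_group X\<^esub> (a \<otimes>\<^bsub>free_group X\<^esub> b \<otimes>\<^bsub>free_group X\<^esub> inv\<^bsub>free_group X\<^esub> a) \<otimes>\<^bsub>free_group X\<^esub> a = b"
      using carr(1,2) unfolding a_def[symmetric] b_def[symmetric]
      by (simp add: F.m_assoc) (simp flip: F.m_assoc)
    ultimately have "b \<in> N" by simp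
    then show False using notN by (simp add: b_def)
  qed
qed auto

text \<open>A representative of minimal length is reduced, since deleting an adjacent inverse pair
  would shorten it.\<close>

lemma free_group_reduced_representative:
  assumes "g \<in> carrier (free_group X)"
  obtains w where "w \<in> lists (X \<times> UNIV)" "reduced_word w" "g = word_cong (free_group_rels X) `` {w}"
proof -
  let ?P = "\<lambda>w. w \<in> lists (X \<times> UNIV) \<and> g = word_cong (free_group_rels X) `` {w}"
  obtain w0 where "?P w0" using assms by (auto simp: free_group_def elim!: word_monoid_carrierE)
  then obtain w where w: "?P w" and min: "\<And>v. ?P v \<Longrightarrow> length w \<le> length v"
    using arg_min_nat_lemma[of ?P w0 length] by blast
  have "reduced_word w"
    unfolding reduced_word_def
  proof clarify
    fix u s v assume uv: "w = u @ [s, flip_letter s] @ v"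
    then have "([s, flip_letter s], []) \<in> free_group_rels X"
      using w by (cases s) (auto simp: free_group_rels_def)
    then have "(u @ [s, flip_letter s] @ v, u @ [] @ v) \<in> word_cong (free_group_rels X)"
      by (intro word_cong.append word_cong.refl word_cong.rel)
    then have "g = word_cong (free_group_rels X) `` {u @ v}"
      using w uv by (simp add: word_cong_class_eq_iff)
    then have "length w \<le> length (u @ v)" using w uv by (intro min) auto
    then show False by (simp add: uv)
  qed
  then show thesis using w that by blast
qed

lemma free_group_derived_series_trivial:
  assumes "g \<in> carrier (free_group X)" "g \<noteq> \<one>\<^bsub>free_group X\<^esub>"
  obtains n where "g \<notin> (derived (free_group X) ^^ n) (carrier (free_group X))"
proof -
  obtain w where w: "w \<in> lists (X \<times> UNIV)" "reduced_word w" "g = word_cong (free_group_rels X) `` {w}"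
    using assms(1) by (rule free_group_reduced_representative)
  then have "w \<noteq> []" using assms(2) by (auto simp: one_free_group)
  \<comment> \<open>The length of the reduced representative serves as \<open>n\<close>.\<close>
  then show thesis using reduced_word_not_in_derived[OF w(1,2) _ order_refl] w(3) that by blast
qed


section \<open>The universal property of generalized free products\<close>

lemma (in group) normal_closure_normal:
  assumes "S \<subseteq> carrier G"
  shows "normal_closure G S \<lhd> G"
proof -
  let ?F = "{N. N \<lhd> G \<and> S \<subseteq> N}"
  have "carrier G \<in> ?F" using assms normal_self by simp
  then have "subgroup (\<Inter>?F) G"
    by (intro subgroups_Inter) (auto simp: normal_imp_subgroup)
  then show ?thesis
    unfolding normal_closure_def normal_inv_iff by (auto simp: normal.inv_op_closed2)
qed

text \<open>Composing with \<open>\<theta> i\<close> parametrizes every factor by the same group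
  \<open>A\<close>. Amalgamation then simply says that these maps agree on \<open>C\<close>, and the
  factors \<open>B i\<close> disappear from the later argument.\<close>

definition generalized_free_product_inj ::
    "'i set \<Rightarrow> ('i \<Rightarrow> ('b, 'n) monoid_scheme) \<Rightarrow> 'c set \<Rightarrow> ('i \<Rightarrow> 'c \<Rightarrow> 'b) \<Rightarrow> 'i \<Rightarrow> 'c
      \<Rightarrow> ('i \<times> 'b) list set set" where
  "generalized_free_product_inj I B C \<theta> i a =
     normal_closure (free_product I B)
       {free_product_inj I B i (\<theta> i c)
          \<otimes>\<^bsub>free_product I B\<^esub> inv\<^bsub>free_product I B\<^esub> (free_product_inj I B j (\<theta> j c))
        | i j c. i \<in> I \<and> j \<in> I \<and> c \<in> C} #>\<^bsub>free_product I B\<^esub> free_product_inj I B i (\<theta> i a)"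

lemma free_product_hom_exists:
  assumes "group H" and f: "\<And>i. i \<in> I \<Longrightarrow> f i \<in> hom (B i) H" and B: "\<And>i. i \<in> I \<Longrightarrow> group (B i)"
  shows "\<exists>h\<in>hom (free_product I B) H. \<forall>i\<in>I. \<forall>x\<in>carrier (B i). h (free_product_inj I B i x) = f i x"
proof -
  interpret group H by fact
  let ?S = "SIGMA i:I. carrier (B i)"
  let ?f = "\<lambda>(i, x). f i x"
  have fc: "f i x \<in> carrier H" if "i \<in> I" "x \<in> carrier (B i)" for i x
    using f[OF that(1)] that(2) by (auto simp: hom_def)
  have "\<exists>h\<in>hom (word_monoid ?S (free_product_rels I B)) H.
      \<forall>s\<in>?S. h (word_cong (free_product_rels I B) `` {[s]}) = ?f s"
  proof (rule word_monoid_hom_exists[OF \<open>group H\<close>])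
    fix u v assume "(u, v) \<in> free_product_rels I B"
    then consider i x y where "i \<in> I" "x \<in> carrier (B i)" "y \<in> carrier (B i)"
        "u = [(i, x), (i, y)]" "v = [(i, x \<otimes>\<^bsub>B i\<^esub> y)]"
      | i where "i \<in> I" "u = [(i, \<one>\<^bsub>B i\<^esub>)]" "v = []"
      by (auto simp: free_product_rels_def)
    then show "u \<in> lists ?S \<and> v \<in> lists ?S \<and> eval_word H ?f u = eval_word H ?f v"
    proof cases
      case 1
      then interpret Bi: group "B i" using B by blast
      show ?thesis using 1 fc hom_mult[OF f[OF 1(1)]] by (simp add: m_assoc[symmetric])
    next
      case 2
      then interpret Bi: group "B i" using B by blast
      show ?thesis using 2 hom_one[OF f[OF 2(1)] Bi.group_axioms \<open>group H\<close>] by simp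
    qed
  qed (use fc in auto)
  then show ?thesis unfolding free_product_def free_product_inj_def by fastforce
qed

context
  fixes A :: "('a, 'm) monoid_scheme" and C :: "'a set" and I :: "'i set"
    and B :: "'i \<Rightarrow> ('b, 'n) monoid_scheme" and \<theta> :: "'i \<Rightarrow> 'a \<Rightarrow> 'b"
  assumes A: "group A" and C: "subgroup C A" and B: "\<And>i. i \<in> I \<Longrightarrow> group (B i)"
    and \<theta>: "\<And>i. i \<in> I \<Longrightarrow> \<theta> i \<in> iso A (B i)"
begin

private abbreviation (input) "P \<equiv> free_product I B"
private abbreviation (input) "G \<equiv> generalized_free_product I B C \<theta>"
private abbreviation (input) "amalgam_rels \<equiv> {free_product_inj I B i (\<theta> i c)
            \<otimes>\<^bsub>P\<^esub> inv\<^bsub>P\<^esub> (free_product_inj I B j (\<theta> j c)) | i j c. i \<in> I \<and> j \<in> I \<and> c \<in> C}"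
private abbreviation (input) "K \<equiv> normal_closure P amalgam_rels"
private abbreviation (input) "\<iota> \<equiv> generalized_free_product_inj I B C \<theta>"

interpretation A: group A by (rule A)
interpretation P: group P by (rule group_free_product) (rule B)

lemma free_product_inj_theta_hom: "i \<in> I \<Longrightarrow> free_product_inj I B i \<circ> \<theta> i \<in> hom A P"
  using \<theta> free_product_inj_hom by (intro hom_compose[of _ _ "B i"]) (auto simp: iso_def)

lemma free_product_inj_theta_closed:
  "i \<in> I \<Longrightarrow> a \<in> carrier A \<Longrightarrow> free_product_inj I B i (\<theta> i a) \<in> carrier P"
  using free_product_inj_theta_hom by (fastforce simp: hom_def)

lemma amalgam_rels_closed: "amalgam_rels \<subseteq> carrier P"
  using subgroup.subset[OF C] by (auto intro!: P.m_closed P.inv_closed free_product_inj_theta_closed)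

lemma K_normal: "K \<lhd> P"
  by (rule P.normal_closure_normal[OF amalgam_rels_closed])

lemma group_generalized_free_product: "group G"
  unfolding generalized_free_product_def by (rule normal.factorgroup_is_group[OF K_normal])

lemma quotient_map_hom: "(\<lambda>x. K #>\<^bsub>P\<^esub> x) \<in> hom P G"
  unfolding generalized_free_product_def by (rule normal.r_coset_hom_Mod[OF K_normal])

lemma generalized_free_product_inj_hom: "i \<in> I \<Longrightarrow> \<iota> i \<in> hom A G"
  using hom_compose[OF free_product_inj_theta_hom quotient_map_hom]
  by (simp add: generalized_free_product_inj_def[abs_def] comp_def)

lemma generalized_free_product_inj_amalgam:
  assumes "i \<in> I" "j \<in> I" "c \<in> C"
  shows "\<iota> i c = \<iota> j c"
proof -
  have c: "c \<in> carrier A" using assms(3) subgroup.mem_carrier[OF C] by blast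
  have "free_product_inj I B i (\<theta> i c) \<otimes>\<^bsub>P\<^esub> inv\<^bsub>P\<^esub> (free_product_inj I B j (\<theta> j c)) \<in> K"
    using assms by (auto simp: normal_closure_def)
  then have "K #>\<^bsub>P\<^esub> (free_product_inj I B i (\<theta> i c) \<otimes>\<^bsub>P\<^esub> inv\<^bsub>P\<^esub> (free_product_inj I B j (\<theta> j c))) = K"
    by (rule subgroup.rcos_const[OF normal_imp_subgroup[OF K_normal] P.group_axioms])
  then show ?thesis
    unfolding generalized_free_product_inj_def
    by (rule P.coset_mult_inv1) (use assms c free_product_inj_theta_closed subgroup.subset[OF normal_imp_subgroup[OF K_normal]] in blast)+
qed

lemma generalized_free_product_generate:
  "generate G (\<Union>i\<in>I. \<iota> i ` carrier A) = carrier G"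
proof -
  interpret q: group_hom P G "\<lambda>x. K #>\<^bsub>P\<^esub> x"
    using quotient_map_hom group_generalized_free_product
    by (simp add: group_hom_def group_hom_axioms_def P.group_axioms)
  let ?S = "(\<lambda>s. word_cong (free_product_rels I B) `` {[s]}) ` (SIGMA i:I. carrier (B i))"
  have S: "generate P ?S = carrier P" "?S \<subseteq> carrier P"
    unfolding free_product_def
    by (auto simp: word_monoid_generate[OF P.group_axioms[unfolded free_product_def]] intro!: word_class_in_carrier)
  have "carrier (B i) = \<theta> i ` carrier A" if "i \<in> I" for i
    using \<theta>[OF that] by (auto simp: iso_def bij_betw_def)
  then have "?S = (\<Union>i\<in>I. (free_product_inj I B i \<circ> \<theta> i) ` carrier A)"
    by (force simp: free_product_inj_def)
  then have "(\<lambda>x. K #>\<^bsub>P\<^esub> x) ` ?S = (\<Union>i\<in>I. \<iota> i ` carrier A)"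
    by (force simp: generalized_free_product_inj_def)
  moreover have "(\<lambda>x. K #>\<^bsub>P\<^esub> x) ` carrier P = carrier G"
    by (simp add: generalized_free_product_def carrier_FactGroup)
  ultimately show ?thesis using q.generate_img[OF S(2)] S(1) by simp
qed

text \<open>The maps \<open>f i\<close>, transported to the \<open>B i\<close> along the inverses of
  \<open>\<theta> i\<close>, extend to the free product. Agreement on \<open>C\<close> puts the
  relators into the kernel of the extension, which is normal and so contains their normal
  closure.\<close>

lemma generalized_free_product_hom_exists:
  assumes "group H" and f: "\<And>i. i \<in> I \<Longrightarrow> f i \<in> hom A H"
    and eq: "\<And>i j c. i \<in> I \<Longrightarrow> j \<in> I \<Longrightarrow> c \<in> C \<Longrightarrow> f i c = f j c"
  shows "\<exists>h\<in>hom G H. \<forall>i\<in>I. \<forall>a\<in>carrier A. h (\<iota> i a) = f i a"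
proof -
  have inv_\<theta>: "inv_into (carrier A) (\<theta> i) \<in> hom (B i) A" if "i \<in> I" for i
    using A.iso_set_sym[OF \<theta>[OF that]] by (simp add: iso_def)
  obtain h where h: "h \<in> hom P H"
    and h': "\<And>i x. i \<in> I \<Longrightarrow> x \<in> carrier (B i) \<Longrightarrow>
      h (free_product_inj I B i x) = f i (inv_into (carrier A) (\<theta> i) x)"
    using free_product_hom_exists[OF \<open>group H\<close>, of I "\<lambda>i. f i \<circ> inv_into (carrier A) (\<theta> i)" B]
      hom_compose[OF inv_\<theta> f] B by auto
  have hf: "h (free_product_inj I B i (\<theta> i a)) = f i a" if "i \<in> I" "a \<in> carrier A" for i a
  proof -
    have "inj_on (\<theta> i) (carrier A)" "\<theta> i a \<in> carrier (B i)"
      using \<theta>[OF that(1)] that(2) by (auto simp: iso_def bij_betw_def)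
    then show ?thesis using that h' by simp
  qed
  interpret h: group_hom P H h
    using h \<open>group H\<close> by (simp add: group_hom_def group_hom_axioms_def P.group_axioms)
  have "amalgam_rels \<subseteq> kernel P H h"
  proof clarify
    fix i j c assume "i \<in> I" "j \<in> I" "c \<in> C"
    moreover from this have "c \<in> carrier A" using subgroup.mem_carrier[OF C] by blast
    moreover from calculation have "f j c \<in> carrier H" using f[of j] by (auto simp: hom_def)
    ultimately show "free_product_inj I B i (\<theta> i c) \<otimes>\<^bsub>P\<^esub> inv\<^bsub>P\<^esub> (free_product_inj I B j (\<theta> j c)) \<in> kernel P H h"
      using eq[of i j c] by (simp add: kernel_def free_product_inj_theta_closed hf)
  qed
  then have "K \<subseteq> kernel P H h"
    using h.normal_kernel by (auto simp: normal_closure_def)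
  then obtain g where "g \<in> hom G H" "\<And>x. x \<in> carrier P \<Longrightarrow> g (K #>\<^bsub>P\<^esub> x) = h x"
    using h.FactGroup_universal_kernel[OF K_normal] unfolding generalized_free_product_def by blast
  then show ?thesis
    by (intro bexI[of _ g]) (simp_all add: generalized_free_product_inj_def free_product_inj_theta_closed hf)
qed

end


section \<open>The kernel of the folding map\<close>

definition semidirect ::
    "('f, 'k) monoid_scheme \<Rightarrow> ('a, 'm) monoid_scheme \<Rightarrow> ('a \<Rightarrow> 'f \<Rightarrow> 'f) \<Rightarrow> ('f \<times> 'a) monoid" where
  "semidirect F A \<alpha> =
     \<lparr>carrier = carrier F \<times> carrier A,
      monoid.mult = (\<lambda>(x, a) (y, b). (x \<otimes>\<^bsub>F\<^esub> \<alpha> a y, a \<otimes>\<^bsub>A\<^esub> b)),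
      one = (\<one>\<^bsub>F\<^esub>, \<one>\<^bsub>A\<^esub>)\<rparr>"

lemma semidirect_simps [simp]:
  "carrier (semidirect F A \<alpha>) = carrier F \<times> carrier A"
  "(x, a) \<otimes>\<^bsub>semidirect F A \<alpha>\<^esub> (y, b) = (x \<otimes>\<^bsub>F\<^esub> \<alpha> a y, a \<otimes>\<^bsub>A\<^esub> b)"
  "\<one>\<^bsub>semidirect F A \<alpha>\<^esub> = (\<one>\<^bsub>F\<^esub>, \<one>\<^bsub>A\<^esub>)"
  by (simp_all add: semidirect_def)

text \<open>Bijectivity of each \<open>\<alpha> a\<close> follows from \<open>comp\<close> and
  \<open>one\<close>, so an action may be given by endomorphisms, which is what the universal
  property of a free group provides.\<close>

lemma group_semidirect:
  assumes "group F" "group A"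
    and hom: "\<And>a. a \<in> carrier A \<Longrightarrow> \<alpha> a \<in> hom F F"
    and comp: "\<And>a b x. a \<in> carrier A \<Longrightarrow> b \<in> carrier A \<Longrightarrow> x \<in> carrier F \<Longrightarrow> \<alpha> (a \<otimes>\<^bsub>A\<^esub> b) x = \<alpha> a (\<alpha> b x)"
    and one: "\<And>x. x \<in> carrier F \<Longrightarrow> \<alpha> \<one>\<^bsub>A\<^esub> x = x"
  shows "group (semidirect F A \<alpha>)"
proof -
  interpret F: group F by fact
  interpret A: group A by fact
  have closed: "\<alpha> a x \<in> carrier F" if "a \<in> carrier A" "x \<in> carrier F" for a x
    using hom[OF that(1)] that(2) by (auto simp: hom_def)
  have mult: "\<alpha> a (x \<otimes>\<^bsub>F\<^esub> y) = \<alpha> a x \<otimes>\<^bsub>F\<^esub> \<alpha> a y" if "a \<in> carrier A" "x \<in> carrier F" "y \<in> carrier F" for a x y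
    using hom[OF that(1)] that(2,3) by (auto simp: hom_def)
  have \<alpha>1: "\<alpha> a \<one>\<^bsub>F\<^esub> = \<one>\<^bsub>F\<^esub>" if "a \<in> carrier A" for a
    using hom_one[OF hom[OF that]] \<open>group F\<close> by blast
  show ?thesis
  proof (rule groupI)
    fix p assume "p \<in> carrier (semidirect F A \<alpha>)"
    then obtain x a where p: "p = (x, a)" "x \<in> carrier F" "a \<in> carrier A" by auto
    show "\<exists>q\<in>carrier (semidirect F A \<alpha>). q \<otimes>\<^bsub>semidirect F A \<alpha>\<^esub> p = \<one>\<^bsub>semidirect F A \<alpha>\<^esub>"
      using p by (intro bexI[of _ "(\<alpha> (inv\<^bsub>A\<^esub> a) (inv\<^bsub>F\<^esub> x), inv\<^bsub>A\<^esub> a)"])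
        (auto simp: closed \<alpha>1 simp flip: mult)
  qed (auto simp: closed mult comp one F.m_assoc A.m_assoc)
qed

text \<open>This isolates compatible, generating copies of \<open>A\<close> from the presentation of
  \<open>G\<close>. The universal property enters later, through the homomorphism
  \<open>\<Phi>\<close> assumed in \<open>folding_kernel_iso_free\<close>.\<close>

locale amalgamated_copies = A: group A + G: group G
  for A :: "('a, 'm) monoid_scheme" (structure) and G :: "('g, 'k) monoid_scheme" (structure) +
  fixes C :: "'a set" and I :: "'i set" and \<iota> :: "'i \<Rightarrow> 'a \<Rightarrow> 'g" and i0 :: 'i
  assumes C: "subgroup C A"
    and \<iota>_hom: "i \<in> I \<Longrightarrow> \<iota> i \<in> hom A G"
    and \<iota>_C: "i \<in> I \<Longrightarrow> j \<in> I \<Longrightarrow> c \<in> C \<Longrightarrow> \<iota> i c = \<iota> j c"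
    and gen: "generate G (\<Union>i\<in>I. \<iota> i ` carrier A) = carrier G"
    and i0: "i0 \<in> I"
begin

abbreviation cosets :: "'a set set" where "cosets \<equiv> lcosets\<^bsub>A\<^esub> C"
abbreviation X :: "('i \<times> 'a set) set" where "X \<equiv> (I - {i0}) \<times> (cosets - {C})"
abbreviation F :: "(('i \<times> 'a set) \<times> bool) list set monoid" where "F \<equiv> free_group X"

text \<open>\<open>Y i (aC)\<close> plays the role of \<open>\<iota> i a (\<iota> i0 a)\<inverse>\<close>, which depends only on the coset \<open>aC\<close>.\<close>

definition Y :: "'i \<Rightarrow> 'a set \<Rightarrow> (('i \<times> 'a set) \<times> bool) list set" where
  "Y i S = (if i = i0 \<or> S = C then \<one>\<^bsub>F\<^esub> else free_gen X (i, S))"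

text \<open>Conjugation by \<open>\<iota> i0 b\<close>, computed in terms of the generators.\<close>

definition act :: "'a \<Rightarrow> (('i \<times> 'a set) \<times> bool) list set \<Rightarrow> (('i \<times> 'a set) \<times> bool) list set" where
  "act b = (SOME h. h \<in> hom F F \<and>
     (\<forall>(i, S)\<in>X. h (free_gen X (i, S)) = inv\<^bsub>F\<^esub> Y i (b <#\<^bsub>A\<^esub> C) \<otimes>\<^bsub>F\<^esub> Y i (b <#\<^bsub>A\<^esub> S)))"

section \<open>Left cosets of \<open>C\<close> and the action of \<open>A\<close> on the free
  group\<close>

sublocale F: group F by (rule group_free_group)

lemma C_sub: "C \<subseteq> carrier A" by (rule subgroup.subset[OF C])

lemma coset_in: "a \<in> carrier A \<Longrightarrow> a <#\<^bsub>A\<^esub> C \<in> cosets"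
  by (auto simp: LCOSETS_def)

lemma cosetE: assumes "S \<in> cosets" obtains a where "a \<in> carrier A" "S = a <#\<^bsub>A\<^esub> C"
  using assms by (auto simp: LCOSETS_def)

lemma coset_act: "a \<in> carrier A \<Longrightarrow> b \<in> carrier A \<Longrightarrow> b <#\<^bsub>A\<^esub> (a <#\<^bsub>A\<^esub> C) = (b \<otimes>\<^bsub>A\<^esub> a) <#\<^bsub>A\<^esub> C"
  by (rule A.lcos_m_assoc[OF C_sub])

lemma coset_one: "\<one>\<^bsub>A\<^esub> <#\<^bsub>A\<^esub> C = C"
  by (rule A.lcos_mult_one[OF C_sub])

lemma C_coset: "C \<in> cosets" using coset_in[OF A.one_closed] coset_one by simp

lemma coset_of_C: "c \<in> C \<Longrightarrow> c <#\<^bsub>A\<^esub> C = C"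
  using A.coset_join3[OF _ C] C_sub by blast

lemma coset_act_in: "b \<in> carrier A \<Longrightarrow> S \<in> cosets \<Longrightarrow> b <#\<^bsub>A\<^esub> S \<in> cosets"
  by (auto elim!: cosetE simp: coset_act coset_in)

lemma Y_closed: "i \<in> I \<Longrightarrow> S \<in> cosets \<Longrightarrow> Y i S \<in> carrier F"
  by (auto simp: Y_def intro!: free_gen_closed)

lemma Y_simps [simp]: "Y i0 S = \<one>\<^bsub>F\<^esub>" "Y i C = \<one>\<^bsub>F\<^esub>" by (auto simp: Y_def)

lemma free_gen_Y: "(i, S) \<in> X \<Longrightarrow> free_gen X (i, S) = Y i S" by (auto simp: Y_def)

text \<open>The formula is imposed on basis elements only. It extends to the trivial symbols: for
  \<open>i = i0\<close> all terms are trivial, and for \<open>S = C\<close> the right-hand side is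
  an element times its inverse.\<close>

lemma act:
  assumes b: "b \<in> carrier A"
  shows act_hom: "act b \<in> hom F F"
    and act_Y: "i \<in> I \<Longrightarrow> S \<in> cosets \<Longrightarrow> act b (Y i S) = inv\<^bsub>F\<^esub> Y i (b <#\<^bsub>A\<^esub> C) \<otimes>\<^bsub>F\<^esub> Y i (b <#\<^bsub>A\<^esub> S)"
proof -
  have "\<exists>h\<in>hom F F. \<forall>p\<in>X. h (free_gen X p) = (\<lambda>(i, S). inv\<^bsub>F\<^esub> Y i (b <#\<^bsub>A\<^esub> C) \<otimes>\<^bsub>F\<^esub> Y i (b <#\<^bsub>A\<^esub> S)) p"
    by (rule free_group_hom_exists[OF F.group_axioms])
      (use b in \<open>auto intro!: Y_closed F.m_closed F.inv_closed coset_act_in C_coset\<close>)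
  then have "\<exists>h. h \<in> hom F F \<and>
     (\<forall>(i, S)\<in>X. h (free_gen X (i, S)) = inv\<^bsub>F\<^esub> Y i (b <#\<^bsub>A\<^esub> C) \<otimes>\<^bsub>F\<^esub> Y i (b <#\<^bsub>A\<^esub> S))"
    by (simp add: case_prod_unfold Bex_def)
  then have *: "act b \<in> hom F F \<and>
     (\<forall>(i, S)\<in>X. act b (free_gen X (i, S)) = inv\<^bsub>F\<^esub> Y i (b <#\<^bsub>A\<^esub> C) \<otimes>\<^bsub>F\<^esub> Y i (b <#\<^bsub>A\<^esub> S))"
    unfolding act_def by (rule someI_ex)
  then show "act b \<in> hom F F" by blast
  show "act b (Y i S) = inv\<^bsub>F\<^esub> Y i (b <#\<^bsub>A\<^esub> C) \<otimes>\<^bsub>F\<^esub> Y i (b <#\<^bsub>A\<^esub> S)" if "i \<in> I" "S \<in> cosets"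
  proof (cases "i = i0 \<or> S = C")
    case True
    moreover have "act b \<one>\<^bsub>F\<^esub> = \<one>\<^bsub>F\<^esub>" using hom_one[of "act b" F F] * F.group_axioms by blast
    moreover have "Y i (b <#\<^bsub>A\<^esub> C) \<in> carrier F" using b that(1) by (intro Y_closed coset_in)
    ultimately show ?thesis by auto
  next
    case False
    then have "(i, S) \<in> X" using that by blast
    then show ?thesis using bspec[OF conjunct2[OF *] \<open>(i, S) \<in> X\<close>] free_gen_Y[OF \<open>(i, S) \<in> X\<close>] by simp
  qed
qed

lemma act_closed: "b \<in> carrier A \<Longrightarrow> u \<in> carrier F \<Longrightarrow> act b u \<in> carrier F"
  by (rule hom_in_carrier[OF act_hom])

lemma hom_eq_on_F:
  assumes "group H" "h \<in> hom F H" "k \<in> hom F H"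
    and "\<And>i a. i \<in> I \<Longrightarrow> a \<in> carrier A \<Longrightarrow> h (Y i (a <#\<^bsub>A\<^esub> C)) = k (Y i (a <#\<^bsub>A\<^esub> C))"
    and "u \<in> carrier F"
  shows "h u = k u"
proof (rule free_group_hom_eq[OF assms(1-3) _ assms(5)])
  fix p assume "p \<in> X"
  then obtain i S where p: "p = (i, S)" "(i, S) \<in> X" by (cases p) blast
  then obtain a where a: "a \<in> carrier A" "S = a <#\<^bsub>A\<^esub> C" by (blast elim: cosetE)
  have "free_gen X p = Y i (a <#\<^bsub>A\<^esub> C)" using free_gen_Y[OF p(2)] p(1) a(2) by simp
  then show "h (free_gen X p) = k (free_gen X p)" using assms(4)[of i a] p(2) a(1) by simp
qed

text \<open>On a generator the claim telescopes. With y(a) for \<open>Y i\<close> of the coset of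
  \<open>a\<close>, applying \<open>act a\<close> to y(b)^-1 y(bc) gives (y(a)^-1 y(ab))^-1 y(a)^-1
  y(abc), where y(a) cancels.\<close>

lemma act_comp:
  assumes "a \<in> carrier A" "b \<in> carrier A" "u \<in> carrier F"
  shows "act (a \<otimes>\<^bsub>A\<^esub> b) u = act a (act b u)"
proof -
  interpret a: group_hom F F "act a"
    using act_hom[OF assms(1)] by (simp add: group_hom_def group_hom_axioms_def F.group_axioms)
  have "act (a \<otimes>\<^bsub>A\<^esub> b) (Y i (c <#\<^bsub>A\<^esub> C)) = (act a \<circ> act b) (Y i (c <#\<^bsub>A\<^esub> C))"
    if "i \<in> I" "c \<in> carrier A" for i c
  proof -
    have cl: "Y i (d <#\<^bsub>A\<^esub> C) \<in> carrier F" if "d \<in> carrier A" for d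
      using \<open>i \<in> I\<close> that by (intro Y_closed coset_in)
    show ?thesis
      using assms that
      by (simp add: act_Y coset_in coset_act cl A.m_assoc F.inv_mult_group F.m_assoc)
        (simp add: cl F.m_assoc[symmetric])
  qed
  then show ?thesis
    using hom_eq_on_F[OF F.group_axioms act_hom[OF A.m_closed[OF assms(1,2)]]
        hom_compose[OF act_hom[OF assms(2)] act_hom[OF assms(1)]] _ assms(3)]
    by (metis comp_apply)
qed

lemma act_one: "u \<in> carrier F \<Longrightarrow> act \<one>\<^bsub>A\<^esub> u = u"
proof -
  assume u: "u \<in> carrier F"
  have "act \<one>\<^bsub>A\<^esub> u = id u"
  proof (rule hom_eq_on_F[OF F.group_axioms act_hom[OF A.one_closed] _ _ u])
    show "id \<in> hom F F" by (simp add: hom_def)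
    fix i a assume "i \<in> I" "a \<in> carrier A"
    then show "act \<one>\<^bsub>A\<^esub> (Y i (a <#\<^bsub>A\<^esub> C)) = id (Y i (a <#\<^bsub>A\<^esub> C))"
      by (simp add: act_Y coset_in coset_act coset_one Y_closed)
  qed
  then show ?thesis by simp
qed

abbreviation "FA \<equiv> semidirect F A act"

sublocale FA: group FA
  by (rule group_semidirect[OF F.group_axioms A.group_axioms act_hom act_comp act_one])

text \<open>The coset symbols form a crossed homomorphism: multiplying \<open>Y i\<close> at
  \<open>a\<close> by the \<open>a\<close>-translate of \<open>Y i\<close> at \<open>b\<close>
  cancels the correcting inverse in the formula for \<open>act\<close>.\<close>

lemma copy_hom: "i \<in> I \<Longrightarrow> (\<lambda>a. (Y i (a <#\<^bsub>A\<^esub> C), a)) \<in> hom A FA"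
proof (rule homI)
  fix a b assume i: "i \<in> I" and ab: "a \<in> carrier A" "b \<in> carrier A"
  have "Y i (a <#\<^bsub>A\<^esub> C) \<in> carrier F" "Y i ((a \<otimes>\<^bsub>A\<^esub> b) <#\<^bsub>A\<^esub> C) \<in> carrier F"
    using i ab by (auto intro!: Y_closed coset_in)
  then have "Y i (a <#\<^bsub>A\<^esub> C) \<otimes>\<^bsub>F\<^esub> act a (Y i (b <#\<^bsub>A\<^esub> C)) = Y i ((a \<otimes>\<^bsub>A\<^esub> b) <#\<^bsub>A\<^esub> C)"
    using i ab by (simp add: act_Y coset_in coset_act F.m_assoc[symmetric])
  then show "(Y i ((a \<otimes>\<^bsub>A\<^esub> b) <#\<^bsub>A\<^esub> C), a \<otimes>\<^bsub>A\<^esub> b) =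
      (Y i (a <#\<^bsub>A\<^esub> C), a) \<otimes>\<^bsub>FA\<^esub> (Y i (b <#\<^bsub>A\<^esub> C), b)"
    by simp
qed (auto intro!: Y_closed coset_in)

section \<open>Comparison of the free group with the kernel in \<open>G\<close>\<close>

lemma \<iota>_closed: "i \<in> I \<Longrightarrow> a \<in> carrier A \<Longrightarrow> \<iota> i a \<in> carrier G"
  by (rule hom_in_carrier[OF \<iota>_hom])

lemma \<iota>_mult: "i \<in> I \<Longrightarrow> a \<in> carrier A \<Longrightarrow> b \<in> carrier A \<Longrightarrow> \<iota> i (a \<otimes>\<^bsub>A\<^esub> b) = \<iota> i a \<otimes>\<^bsub>G\<^esub> \<iota> i b"
  by (rule hom_mult[OF \<iota>_hom])

text \<open>If \<open>a\<close> is \<open>b\<close> times an element \<open>c\<close> of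
  \<open>C\<close>, the contributions of \<open>c\<close> cancel because all copies agree on
  \<open>C\<close>.\<close>

lemma difference_cong:
  assumes "i \<in> I" "a \<in> carrier A" "b \<in> carrier A" "a <#\<^bsub>A\<^esub> C = b <#\<^bsub>A\<^esub> C"
  shows "\<iota> i a \<otimes>\<^bsub>G\<^esub> inv\<^bsub>G\<^esub> \<iota> i0 a = \<iota> i b \<otimes>\<^bsub>G\<^esub> inv\<^bsub>G\<^esub> \<iota> i0 b"
proof -
  have "a \<in> b <#\<^bsub>A\<^esub> C" using A.lcos_self[OF assms(2) C] assms(4) by simp
  then obtain c where c: "c \<in> C" "a = b \<otimes>\<^bsub>A\<^esub> c" by (auto simp: l_coset_def)
  have cA: "c \<in> carrier A" using c C_sub by blast
  have cl: "\<iota> i b \<in> carrier G" "\<iota> i0 b \<in> carrier G" "\<iota> i0 c \<in> carrier G"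
    using assms i0 cA by (auto intro: \<iota>_closed)
  have "\<iota> i a \<otimes>\<^bsub>G\<^esub> inv\<^bsub>G\<^esub> \<iota> i0 a = (\<iota> i b \<otimes>\<^bsub>G\<^esub> \<iota> i0 c) \<otimes>\<^bsub>G\<^esub> (inv\<^bsub>G\<^esub> \<iota> i0 c \<otimes>\<^bsub>G\<^esub> inv\<^bsub>G\<^esub> \<iota> i0 b)"
    using c cA assms i0 cl \<iota>_C[OF assms(1) i0 c(1)] by (simp add: \<iota>_mult G.inv_mult_group)
  also have "\<dots> = \<iota> i b \<otimes>\<^bsub>G\<^esub> inv\<^bsub>G\<^esub> \<iota> i0 b"
    using cl by (simp add: G.m_assoc) (simp flip: G.m_assoc)
  finally show ?thesis .
qed

lemma kernel_hom_exists:
  obtains \<Psi> where "\<Psi> \<in> hom F G"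
    "\<And>i a. i \<in> I \<Longrightarrow> a \<in> carrier A \<Longrightarrow> \<Psi> (Y i (a <#\<^bsub>A\<^esub> C)) = \<iota> i a \<otimes>\<^bsub>G\<^esub> inv\<^bsub>G\<^esub> \<iota> i0 a"
proof -
  \<comment> \<open>An arbitrary representative of each coset; by \<open>difference_cong\<close> the
    choice does not affect the value of \<open>d\<close>.\<close>
  define rep where "rep S = (SOME a. a \<in> carrier A \<and> S = a <#\<^bsub>A\<^esub> C)" for S
  have rep: "rep S \<in> carrier A \<and> S = rep S <#\<^bsub>A\<^esub> C" if "S \<in> cosets" for S
    unfolding rep_def by (rule someI_ex) (use that in \<open>auto elim: cosetE\<close>)
  define d where "d i a = \<iota> i a \<otimes>\<^bsub>G\<^esub> inv\<^bsub>G\<^esub> \<iota> i0 a" for i a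
  have "\<exists>h\<in>hom F G. \<forall>p\<in>X. h (free_gen X p) = (\<lambda>(i, S). d i (rep S)) p"
    by (rule free_group_hom_exists[OF G.group_axioms])
      (use rep i0 in \<open>auto simp: d_def intro!: G.m_closed G.inv_closed \<iota>_closed\<close>)
  then obtain h where h: "h \<in> hom F G"
    and h': "\<And>p. p \<in> X \<Longrightarrow> h (free_gen X p) = (\<lambda>(i, S). d i (rep S)) p"
    by blast
  have hX: "h (Y i S) = d i (rep S)" if "(i, S) \<in> X" for i S
    using h'[OF that] free_gen_Y[OF that] by simp
  have "h (Y i (a <#\<^bsub>A\<^esub> C)) = d i a" if "i \<in> I" "a \<in> carrier A" for i a
  proof (cases "i = i0 \<or> a <#\<^bsub>A\<^esub> C = C")
    case True
    \<comment> \<open>The symbol \<open>Y\<close> is trivial here, so the difference must be too: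
      either both copies are the same one, or \<open>a\<close> lies in \<open>C\<close>, where the
      copies agree.\<close>
    have "d i a = \<one>\<^bsub>G\<^esub>"
    proof (cases "i = i0")
      case True
      then show ?thesis using i0 that by (simp add: d_def \<iota>_closed)
    next
      case False
      then have "a \<in> C" using \<open>i = i0 \<or> a <#\<^bsub>A\<^esub> C = C\<close> A.lcos_self[OF that(2) C] by simp
      then show ?thesis using i0 that \<iota>_C[of i i0 a] by (simp add: d_def \<iota>_closed)
    qed
    moreover have "h \<one>\<^bsub>F\<^esub> = \<one>\<^bsub>G\<^esub>" using hom_one[OF h F.group_axioms G.group_axioms] .
    ultimately show ?thesis using True by auto
  next
    case False
    then have "h (Y i (a <#\<^bsub>A\<^esub> C)) = d i (rep (a <#\<^bsub>A\<^esub> C))" using that coset_in by (intro hX) auto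
    also have "\<dots> = d i a"
      unfolding d_def using rep[OF coset_in[OF that(2)]] that by (intro difference_cong) auto
    finally show ?thesis .
  qed
  then show thesis using h that unfolding d_def by blast
qed

text \<open>The inverse of \<open>fst \<circ> \<Phi>\<close> on the kernel is the map
  \<open>\<Psi>\<close> that realizes the symbols as elements of \<open>G\<close>. To see this,
  \<open>\<Psi>\<close> is extended to a map \<open>\<Sigma>\<close> on the whole semidirect product
  that undoes \<open>\<Phi>\<close>.\<close>

lemma folding_kernel_iso_free:
  assumes \<Phi>: "\<Phi> \<in> hom G FA"
    and \<Phi>_\<iota>: "\<And>i a. i \<in> I \<Longrightarrow> a \<in> carrier A \<Longrightarrow> \<Phi> (\<iota> i a) = (Y i (a <#\<^bsub>A\<^esub> C), a)"
  shows "snd \<circ> \<Phi> \<in> hom G A"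
    and "fst \<circ> \<Phi> \<in> iso (G\<lparr>carrier := kernel G A (snd \<circ> \<Phi>)\<rparr>) F"
proof -
  obtain \<Psi> where \<Psi>: "\<Psi> \<in> hom F G" and \<Psi>_Y:
    "\<And>i a. i \<in> I \<Longrightarrow> a \<in> carrier A \<Longrightarrow> \<Psi> (Y i (a <#\<^bsub>A\<^esub> C)) = \<iota> i a \<otimes>\<^bsub>G\<^esub> inv\<^bsub>G\<^esub> \<iota> i0 a"
    using kernel_hom_exists by blast
  interpret \<Psi>: group_hom F G \<Psi>
    using \<Psi> by (simp add: group_hom_def group_hom_axioms_def F.group_axioms G.group_axioms)
  interpret \<Phi>: group_hom G FA \<Phi>
    using \<Phi> by (simp add: group_hom_def group_hom_axioms_def FA.group_axioms G.group_axioms)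
  have ic [simp]: "\<iota> i a \<in> carrier G" if "i \<in> I" "a \<in> carrier A" for i a
    using that by (rule \<iota>_closed)
  note [simp] = i0

  \<comment> \<open>This makes \<open>\<Sigma>\<close> multiplicative. Both sides are homomorphisms
    in \<open>u\<close>, and on generators the identity is the computation that motivated
    \<open>act\<close>.\<close>
  have equivariant: "\<iota> i0 b \<otimes>\<^bsub>G\<^esub> \<Psi> u \<otimes>\<^bsub>G\<^esub> inv\<^bsub>G\<^esub> \<iota> i0 b = \<Psi> (act b u)"
    if b: "b \<in> carrier A" and u: "u \<in> carrier F" for b u
  proof -
    have conj: "(\<lambda>u. \<iota> i0 b \<otimes>\<^bsub>G\<^esub> \<Psi> u \<otimes>\<^bsub>G\<^esub> inv\<^bsub>G\<^esub> \<iota> i0 b) \<in> hom F G"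
      using b by (intro homI) (simp_all add: G.m_assoc, simp flip: G.m_assoc)
    have "\<iota> i0 b \<otimes>\<^bsub>G\<^esub> \<Psi> u \<otimes>\<^bsub>G\<^esub> inv\<^bsub>G\<^esub> \<iota> i0 b = (\<Psi> \<circ> act b) u"
    proof (rule hom_eq_on_F[OF G.group_axioms conj _ _ u])
      show "\<Psi> \<circ> act b \<in> hom F G" by (rule hom_compose[OF act_hom[OF b] \<Psi>])
      fix i a assume ia: "i \<in> I" "a \<in> carrier A"
      have "\<Psi> (act b (Y i (a <#\<^bsub>A\<^esub> C))) =
          inv\<^bsub>G\<^esub> (\<iota> i b \<otimes>\<^bsub>G\<^esub> inv\<^bsub>G\<^esub> \<iota> i0 b) \<otimes>\<^bsub>G\<^esub> (\<iota> i (b \<otimes>\<^bsub>A\<^esub> a) \<otimes>\<^bsub>G\<^esub> inv\<^bsub>G\<^esub> \<iota> i0 (b \<otimes>\<^bsub>A\<^esub> a))"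
        using b ia by (simp add: act_Y coset_in coset_act Y_closed \<Psi>_Y)
      also have "\<dots> = \<iota> i0 b \<otimes>\<^bsub>G\<^esub> (\<iota> i a \<otimes>\<^bsub>G\<^esub> inv\<^bsub>G\<^esub> \<iota> i0 a) \<otimes>\<^bsub>G\<^esub> inv\<^bsub>G\<^esub> \<iota> i0 b"
        using b ia by (simp add: \<iota>_mult G.inv_mult_group G.m_assoc)
          (simp add: G.m_assoc[symmetric])
      finally show "\<iota> i0 b \<otimes>\<^bsub>G\<^esub> \<Psi> (Y i (a <#\<^bsub>A\<^esub> C)) \<otimes>\<^bsub>G\<^esub> inv\<^bsub>G\<^esub> \<iota> i0 b = (\<Psi> \<circ> act b) (Y i (a <#\<^bsub>A\<^esub> C))"
        using ia by (simp add: \<Psi>_Y)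
    qed
    then show ?thesis by simp
  qed

  define \<Sigma> where "\<Sigma> = (\<lambda>(u, a). \<Psi> u \<otimes>\<^bsub>G\<^esub> \<iota> i0 a)"
  have \<Sigma>: "\<Sigma> \<in> hom FA G"
  proof (rule homI)
    fix p q assume "p \<in> carrier FA" "q \<in> carrier FA"
    then obtain u a v b where p: "p = (u, a)" "u \<in> carrier F" "a \<in> carrier A"
      and q: "q = (v, b)" "v \<in> carrier F" "b \<in> carrier A" by auto
    have "\<Psi> (act a v) = \<iota> i0 a \<otimes>\<^bsub>G\<^esub> \<Psi> v \<otimes>\<^bsub>G\<^esub> inv\<^bsub>G\<^esub> \<iota> i0 a"
      using equivariant p q by simp
    then show "\<Sigma> (p \<otimes>\<^bsub>FA\<^esub> q) = \<Sigma> p \<otimes>\<^bsub>G\<^esub> \<Sigma> q"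
      using p q by (simp add: \<Sigma>_def act_closed \<iota>_mult G.m_assoc) (simp add: G.m_assoc[symmetric])
  qed (auto simp: \<Sigma>_def)
  have \<Sigma>\<Phi>: "\<Sigma> (\<Phi> g) = g" if "g \<in> carrier G" for g
  proof -
    have "(\<Sigma> \<circ> \<Phi>) g = id g"
    proof (rule hom_eq_on_generate[OF G.group_axioms G.group_axioms hom_compose[OF \<Phi> \<Sigma>]])
      show "id \<in> hom G G" by (simp add: hom_def)
      show "(\<Union>i\<in>I. \<iota> i ` carrier A) \<subseteq> carrier G" by auto
      show "g \<in> generate G (\<Union>i\<in>I. \<iota> i ` carrier A)" using that gen by simp
      fix s assume "s \<in> (\<Union>i\<in>I. \<iota> i ` carrier A)"
      then obtain i a where "i \<in> I" "a \<in> carrier A" "s = \<iota> i a" by blast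
      then show "(\<Sigma> \<circ> \<Phi>) s = id s" by (simp add: \<Phi>_\<iota> \<Sigma>_def \<Psi>_Y G.m_assoc)
    qed
    then show ?thesis by simp
  qed
  have incl: "(\<lambda>u. (u, \<one>\<^bsub>A\<^esub>)) \<in> hom F FA"
    by (rule homI) (auto simp: act_one)
  have \<Phi>\<Psi>: "\<Phi> (\<Psi> u) = (u, \<one>\<^bsub>A\<^esub>)" if "u \<in> carrier F" for u
  proof (rule hom_eq_on_F[OF FA.group_axioms hom_compose[OF \<Psi> \<Phi>] incl _ that, unfolded comp_apply])
    fix i a assume ia: "i \<in> I" "a \<in> carrier A"
    \<comment> \<open>Since \<open>Y i0\<close> is trivial, \<open>\<Phi>\<close> sends
      \<open>\<iota> i0 a\<close> to the pair with second entry \<open>a\<close> and trivial first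
      entry. Multiplying by it turns the difference back into \<open>\<iota> i a\<close>, where
      \<open>\<Phi>\<close> is known; afterwards it is cancelled.\<close>
    have "(Y i (a <#\<^bsub>A\<^esub> C), a) = \<Phi> (\<Psi> (Y i (a <#\<^bsub>A\<^esub> C)) \<otimes>\<^bsub>G\<^esub> \<iota> i0 a)"
      using ia by (simp add: \<Psi>_Y G.m_assoc \<Phi>_\<iota>)
    also have "\<dots> = \<Phi> (\<Psi> (Y i (a <#\<^bsub>A\<^esub> C))) \<otimes>\<^bsub>FA\<^esub> (\<one>\<^bsub>F\<^esub>, a)"
      using ia by (simp add: \<Phi>_\<iota> Y_closed coset_in del: semidirect_simps)
    finally have "\<Phi> (\<Psi> (Y i (a <#\<^bsub>A\<^esub> C))) \<otimes>\<^bsub>FA\<^esub> (\<one>\<^bsub>F\<^esub>, a) = (Y i (a <#\<^bsub>A\<^esub> C), \<one>\<^bsub>A\<^esub>) \<otimes>\<^bsub>FA\<^esub> (\<one>\<^bsub>F\<^esub>, a)"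
      using ia by (simp add: act_one Y_closed coset_in)
    moreover have "\<Phi> (\<Psi> (Y i (a <#\<^bsub>A\<^esub> C))) \<in> carrier FA"
      using ia by (intro \<Phi>.hom_closed \<Psi>.hom_closed Y_closed coset_in)
    ultimately show "\<Phi> (\<Psi> (Y i (a <#\<^bsub>A\<^esub> C))) = (Y i (a <#\<^bsub>A\<^esub> C), \<one>\<^bsub>A\<^esub>)"
      using ia by (elim iffD1[OF FA.right_cancel, rotated 3]) (simp_all add: Y_closed coset_in)
  qed

  have \<Phi>_carrier: "fst (\<Phi> g) \<in> carrier F" "snd (\<Phi> g) \<in> carrier A" if "g \<in> carrier G" for g
    using \<Phi>.hom_closed[OF that] by auto
  have \<Phi>_mult: "\<Phi> (g \<otimes>\<^bsub>G\<^esub> h) = (fst (\<Phi> g) \<otimes>\<^bsub>F\<^esub> act (snd (\<Phi> g)) (fst (\<Phi> h)), snd (\<Phi> g) \<otimes>\<^bsub>A\<^esub> snd (\<Phi> h))"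
    if "g \<in> carrier G" "h \<in> carrier G" for g h
    using \<Phi>.hom_mult[OF that] semidirect_simps(2) by (metis prod.collapse)
  show snd_hom: "snd \<circ> \<Phi> \<in> hom G A"
    by (rule homI) (auto simp: \<Phi>_carrier \<Phi>_mult simp del: \<Phi>.hom_mult)
  \<comment> \<open>A first projection is not multiplicative on a semidirect product, but on the
    kernel the acting component is the identity.\<close>
  have "fst \<circ> \<Phi> \<in> hom (G\<lparr>carrier := kernel G A (snd \<circ> \<Phi>)\<rparr>) F"
    by (rule homI) (auto simp: kernel_def \<Phi>_carrier \<Phi>_mult act_one simp del: \<Phi>.hom_mult)
  moreover have "bij_betw (fst \<circ> \<Phi>) (kernel G A (snd \<circ> \<Phi>)) (carrier F)"
  proof (rule bij_betw_byWitness[where f' = \<Psi>])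
    show "\<forall>g\<in>kernel G A (snd \<circ> \<Phi>). \<Psi> ((fst \<circ> \<Phi>) g) = g"
    proof
      fix g assume "g \<in> kernel G A (snd \<circ> \<Phi>)"
      then have g: "g \<in> carrier G" "snd (\<Phi> g) = \<one>\<^bsub>A\<^esub>" by (auto simp: kernel_def)
      have "\<iota> i0 \<one>\<^bsub>A\<^esub> = \<one>\<^bsub>G\<^esub>" using hom_one[OF \<iota>_hom[OF i0] A.group_axioms G.group_axioms] .
      then have "\<Sigma> (\<Phi> g) = \<Psi> (fst (\<Phi> g))"
        using g \<Phi>_carrier[OF g(1)] by (simp add: \<Sigma>_def case_prod_unfold)
      then show "\<Psi> ((fst \<circ> \<Phi>) g) = g" using \<Sigma>\<Phi>[OF g(1)] by simp
    qed
  qed (auto simp: \<Phi>\<Psi> kernel_def \<Phi>_carrier)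
  ultimately show "fst \<circ> \<Phi> \<in> iso (G\<lparr>carrier := kernel G A (snd \<circ> \<Phi>)\<rparr>) F"
    by (simp add: iso_def)
qed

end


section \<open>Free-by-nilpotent groups\<close>

lemma lower_central_series_closed:
  assumes "group G" shows "lower_central_series G n \<subseteq> carrier G"
proof -
  interpret group G by fact
  show ?thesis
  proof (induction n)
    case (Suc n)
    then show ?case
      by (simp only: lower_central_series.simps) (rule generate_incl, blast intro: m_closed inv_closed)
  qed simp
qed

lemma one_in_lower_central_series:
  assumes "group G" shows "\<one>\<^bsub>G\<^esub> \<in> lower_central_series G n"
proof -
  interpret group G by fact
  show ?thesis by (cases n) (auto intro: generate.one)
qed

lemma (in group_hom) lower_central_series_image:
  "h ` lower_central_series G n \<subseteq> lower_central_series H n"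
proof (induction n)
  case 0
  then show ?case by auto
next
  case (Suc n)
  let ?S = "\<lambda>K. {x \<otimes>\<^bsub>K\<^esub> y \<otimes>\<^bsub>K\<^esub> inv\<^bsub>K\<^esub> x \<otimes>\<^bsub>K\<^esub> inv\<^bsub>K\<^esub> y | x y. x \<in> lower_central_series K n \<and> y \<in> carrier K}"
  have closed: "x \<in> carrier G" if "x \<in> lower_central_series G n" for x
    using lower_central_series_closed[OF G.group_axioms] that by blast
  have S: "?S G \<subseteq> carrier G" using closed by blast
  have "h ` ?S G \<subseteq> ?S H"
  proof clarify
    fix x y assume x: "x \<in> lower_central_series G n" and y: "y \<in> carrier G"
    have "h (x \<otimes> y \<otimes> inv x \<otimes> inv y) = h x \<otimes>\<^bsub>H\<^esub> h y \<otimes>\<^bsub>H\<^esub> inv\<^bsub>H\<^esub> h x \<otimes>\<^bsub>H\<^esub> inv\<^bsub>H\<^esub> h y"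
      using closed[OF x] y by simp
    then show "\<exists>x' y'. h (x \<otimes> y \<otimes> inv x \<otimes> inv y) = x' \<otimes>\<^bsub>H\<^esub> y' \<otimes>\<^bsub>H\<^esub> inv\<^bsub>H\<^esub> x' \<otimes>\<^bsub>H\<^esub> inv\<^bsub>H\<^esub> y' \<and>
        x' \<in> lower_central_series H n \<and> y' \<in> carrier H"
      using Suc x hom_closed[OF y] by blast
  qed
  then have "generate H (h ` ?S G) \<subseteq> generate H (?S H)"
    by (rule mono_generate)
  then show ?case using generate_img[OF S] by simp
qed

lemma nilpotent_group_inj_hom:
  assumes "group G" "nilpotent_group H" "h \<in> hom G H" "inj_on h (carrier G)"
  shows "nilpotent_group G"
proof -
  obtain n where n: "lower_central_series H n = {\<one>\<^bsub>H\<^esub>}" and H: "group H"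
    using assms(2) by (auto simp: nilpotent_group_def)
  interpret group_hom G H h using assms H by (simp add: group_hom_def group_hom_axioms_def)
  have "x = \<one>\<^bsub>G\<^esub>" if "x \<in> lower_central_series G n" for x
  proof -
    have "h x = \<one>\<^bsub>H\<^esub>" using lower_central_series_image[of n] n that by blast
    then show ?thesis
      using lower_central_series_closed[OF G.group_axioms] that assms(4) by (metis G.one_closed hom_one inj_onD subsetD)
  qed
  then show ?thesis
    using one_in_lower_central_series[OF G.group_axioms] G.group_axioms unfolding nilpotent_group_def by blast
qed

text \<open>A commutator of two elements of the \<open>n\<close>-th term is in particular one with a
  second entry in \<open>G\<close>; hence nilpotent groups are solvable.\<close>

lemma (in group) exp_of_derived_subset_lower_central_series:
  "(derived G ^^ n) (carrier G) \<subseteq> lower_central_series G n"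
proof (induction n)
  case (Suc n)
  have "derived_set G ((derived G ^^ n) (carrier G))
      \<subseteq> {x \<otimes> y \<otimes> inv x \<otimes> inv y | x y. x \<in> lower_central_series G n \<and> y \<in> carrier G}"
    using Suc lower_central_series_closed[OF group_axioms, of n] by blast
  then have "derived G ((derived G ^^ n) (carrier G)) \<subseteq> lower_central_series G (Suc n)"
    unfolding derived_def[of G "(derived G ^^ n) (carrier G)"] lower_central_series.simps
    by (rule mono_generate)
  then show ?case by simp
qed simp

text \<open>If the lower central series of \<open>A\<close> ends at \<open>m\<close>, the
  \<open>m\<close>-th derived term of \<open>G\<close> lies in the kernel, so the
  \<open>(k + m)\<close>-th lies in the \<open>k\<close>-th derived term of the kernel. For
  \<open>g\<close> in the kernel, freeness yields a \<open>k\<close> that excludes it.\<close>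

lemma free_by_nilpotent_derived_series_trivial:
  assumes "group G" "nilpotent_group A" "p \<in> hom G A"
    and r: "r \<in> iso (G\<lparr>carrier := kernel G A p\<rparr>) (free_group X)"
    and g: "g \<in> carrier G" "g \<noteq> \<one>\<^bsub>G\<^esub>"
  obtains n where "g \<notin> (derived G ^^ n) (carrier G)"
proof (rule ccontr)
  assume "\<not> thesis"
  with that have all: "g \<in> (derived G ^^ n) (carrier G)" for n by blast
  obtain m where m: "lower_central_series A m = {\<one>\<^bsub>A\<^esub>}" and A: "group A"
    using assms(2) by (auto simp: nilpotent_group_def)
  interpret p: group_hom G A p using assms A by (simp add: group_hom_def group_hom_axioms_def)
  let ?K = "kernel G A p"
  interpret K: subgroup ?K G by (rule p.subgroup_kernel)
  have "(derived A ^^ m) (carrier A) \<subseteq> {\<one>\<^bsub>A\<^esub>}"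
    using p.H.exp_of_derived_subset_lower_central_series[of m] m by simp
  moreover have "p ` (derived G ^^ m) (carrier G) = (derived A ^^ m) (p ` carrier G)"
    by (rule p.exp_of_derived_img[symmetric]) simp
  moreover have "(derived A ^^ m) (p ` carrier G) \<subseteq> (derived A ^^ m) (carrier A)"
    by (rule p.H.mono_exp_of_derived) auto
  ultimately have "p x = \<one>\<^bsub>A\<^esub>" if "x \<in> (derived G ^^ m) (carrier G)" for x
    using that by blast
  then have sub: "(derived G ^^ m) (carrier G) \<subseteq> ?K"
    using p.G.exp_of_derived_in_carrier[of "carrier G" m] unfolding kernel_def by blast
  have gK: "g \<in> ?K" using all[of m] sub by blast
  interpret GK: group "G\<lparr>carrier := ?K\<rparr>" by (rule K.subgroup_is_group[OF p.G.group_axioms])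
  interpret F: group "free_group X" by (rule group_free_group)
  interpret r: group_hom "G\<lparr>carrier := ?K\<rparr>" "free_group X" r
    using r by (simp add: group_hom_def group_hom_axioms_def iso_def GK.group_axioms F.group_axioms)
  have "inj_on r ?K" using r by (auto simp: iso_def bij_betw_def)
  moreover have "r \<one>\<^bsub>G\<^esub> = \<one>\<^bsub>free_group X\<^esub>" using r.hom_one by simp
  ultimately have "r g \<noteq> \<one>\<^bsub>free_group X\<^esub>"
    using gK g(2) inj_onD[of r ?K g "\<one>\<^bsub>G\<^esub>"] K.one_closed by auto
  then obtain k where k: "r g \<notin> (derived (free_group X) ^^ k) (carrier (free_group X))"
    using free_group_derived_series_trivial[of "r g" X] r.hom_closed[of g] gK by auto
  have "(derived G ^^ (k + m)) (carrier G) \<subseteq> (derived G ^^ k) ?K"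
    unfolding funpow_add comp_apply by (rule p.G.mono_exp_of_derived[OF sub])
  moreover have "(derived (G\<lparr>carrier := ?K\<rparr>) ^^ k) ?K = (derived G ^^ k) ?K" for k
  proof (induction k)
    case (Suc k)
    have "(derived (G\<lparr>carrier := ?K\<rparr>) ^^ k) ?K \<subseteq> ?K"
      using GK.exp_of_derived_in_carrier[of ?K k] by simp
    then have "derived (G\<lparr>carrier := ?K\<rparr>) ((derived G ^^ k) ?K) = derived G ((derived G ^^ k) ?K)"
      unfolding Suc by (intro p.G.derived_consistent K.is_subgroup)
    then show ?case by (simp add: Suc)
  qed simp
  ultimately have "g \<in> (derived (G\<lparr>carrier := ?K\<rparr>) ^^ k) ?K" using all by blast
  then have "r g \<in> (derived (free_group X) ^^ k) (r ` ?K)"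
    using r.exp_of_derived_img[of ?K k] by simp
  then show False
    using k F.mono_exp_of_derived[of "r ` ?K" "carrier (free_group X)" k] r.hom_closed
    by (auto simp: image_subset_iff)
qed

text \<open>The solvable group detecting \<open>g\<close> is \<open>G\<close> modulo a derived term
  that misses \<open>g\<close>; derived terms map onto derived terms, so its derived series reaches
  the identity.\<close>

lemma (in group) residually_solvableI:
  assumes "\<And>g. g \<in> carrier G \<Longrightarrow> g \<noteq> \<one> \<Longrightarrow> \<exists>n. g \<notin> (derived G ^^ n) (carrier G)"
  shows "residually_solvable G"
  unfolding residually_solvable_def
proof (intro conjI ballI impI is_group)
  fix g assume g: "g \<in> carrier G" "g \<noteq> \<one>"
  then obtain n where n: "g \<notin> (derived G ^^ n) (carrier G)" using assms by blast
  define D where "D = (derived G ^^ n) (carrier G)"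
  interpret D: normal D G unfolding D_def by (rule exp_of_derived_is_normal)
  interpret q: group_hom G "G Mod D" "\<lambda>x. D #> x"
    using D.r_coset_hom_Mod D.factorgroup_is_group by (simp add: group_hom_def group_hom_axioms_def)
  have surj: "(\<lambda>x. D #> x) ` carrier G = carrier (G Mod D)" by (simp add: carrier_FactGroup)
  have "(derived (G Mod D) ^^ n) (carrier (G Mod D)) = (\<lambda>x. D #> x) ` D"
    using q.exp_of_derived_img[OF subset_refl, of n] surj by (simp add: D_def)
  also have "\<dots> = {\<one>\<^bsub>G Mod D\<^esub>}"
    using D.rcos_const[OF is_group] image_constant[OF D.one_closed] by (simp cong: image_cong)
  finally have "solvable (G Mod D)" by (auto simp: q.H.solvable_iff_trivial_derived_seq)
  moreover have "(\<lambda>x. D #> x) \<in> epi G (G Mod D)" using q.homh surj by (simp add: epi_def)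
  moreover have "D #> g \<noteq> \<one>\<^bsub>G Mod D\<^esub>"
    using n g(1) rcos_self[OF g(1) D.is_subgroup] unfolding D_def[symmetric] by auto
  ultimately show "\<exists>(H :: 'a set monoid) h. group H \<and> solvable H \<and> h \<in> epi G H \<and> h g \<noteq> \<one>\<^bsub>H\<^esub>"
    using q.H.group_axioms by blast
qed

lemma free_by_nilpotent:
  fixes G :: "'g monoid"
  assumes "group G" "nilpotent_group A" "p \<in> hom G A"
    and r: "r \<in> iso (G\<lparr>carrier := kernel G A p\<rparr>) (free_group X)"
  shows "(\<exists>(N :: 'g monoid) (Q :: 'g set monoid). is_free_group N \<and> nilpotent_group Q \<and> is_extension G N Q)
    \<and> residually_solvable G"
proof
  have A: "group A" using assms(2) by (simp add: nilpotent_group_def)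
  interpret p: group_hom G A p using assms A by (simp add: group_hom_def group_hom_axioms_def)
  let ?K = "kernel G A p"
  interpret K: normal ?K G by (rule p.normal_kernel)
  have N: "group (G\<lparr>carrier := ?K\<rparr>)" by (rule K.subgroup_is_group[OF p.G.group_axioms])
  \<comment> \<open>As \<open>p\<close> is not assumed onto, the quotient is \<open>G Mod ?K\<close>
    instead of \<open>A\<close>. It embeds into \<open>A\<close> and inherits nilpotency from
    there.\<close>
  have Q: "nilpotent_group (G Mod ?K)"
    by (rule nilpotent_group_inj_hom[OF K.factorgroup_is_group assms(2) p.FactGroup_hom p.FactGroup_inj_on])
  have "(\<lambda>x. x) \<in> mon (G\<lparr>carrier := ?K\<rparr>) G"
    using K.subset by (auto simp: mon_def hom_def)
  moreover have "(\<lambda>x. ?K #>\<^bsub>G\<^esub> x) \<in> epi G (G Mod ?K)"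
    using K.r_coset_hom_Mod by (simp add: epi_def carrier_FactGroup)
  moreover have "kernel G (G Mod ?K) (\<lambda>x. ?K #>\<^bsub>G\<^esub> x) = ?K"
    using K.rcos_const[OF p.G.group_axioms] p.G.rcos_self[OF _ K.is_subgroup] K.subset by (auto simp: kernel_def[of G "G Mod ?K"])
  ultimately have "is_extension G (G\<lparr>carrier := ?K\<rparr>) (G Mod ?K)"
    unfolding is_extension_def using p.G.group_axioms N K.factorgroup_is_group
    by (intro conjI exI[of _ "\<lambda>x. x"] exI[of _ "\<lambda>x. ?K #>\<^bsub>G\<^esub> x"]) simp_all
  then show "\<exists>(N :: 'g monoid) (Q :: 'g set monoid). is_free_group N \<and> nilpotent_group Q \<and> is_extension G N Q"
    using is_free_groupI[OF N r] Q by blast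
  show "residually_solvable G"
    using free_by_nilpotent_derived_series_trivial[OF assms] by (intro p.G.residually_solvableI) blast
qed

lemma generalized_free_product_free_by_retract:
  fixes A :: "('a, 'm) monoid_scheme" and I :: "'i set"
  assumes "group A" "subgroup C A" "\<And>i. i \<in> I \<Longrightarrow> group (B i)" "\<And>i. i \<in> I \<Longrightarrow> \<theta> i \<in> iso A (B i)"
  shows "\<exists>p r (X :: ('i \<times> 'a set) set). p \<in> hom (generalized_free_product I B C \<theta>) A \<and>
    r \<in> iso (generalized_free_product I B C \<theta>\<lparr>carrier := kernel (generalized_free_product I B C \<theta>) A p\<rparr>) (free_group X)"
proof -
  let ?G = "generalized_free_product I B C \<theta>" and ?\<iota> = "generalized_free_product_inj I B C \<theta>"
  interpret A: group A by fact
  interpret G: group ?G by (rule group_generalized_free_product[where A = A and C = C and I = I and B = B and \<theta> = \<theta>, OF assms])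
  have gen: "generate ?G (\<Union>i\<in>I. ?\<iota> i ` carrier A) = carrier ?G"
    by (rule generalized_free_product_generate[where A = A and C = C and I = I and B = B and \<theta> = \<theta>, OF assms])
  show ?thesis
  proof (cases "I = {}")
    \<comment> \<open>Without factors there is no base index \<open>i0\<close>. Then
      \<open>G\<close> is generated by the empty set, hence trivial, and its kernel is free on the
      empty set.\<close>
    case True
    have "carrier ?G = {\<one>\<^bsub>?G\<^esub>}"
      using gen G.generate_empty by (simp add: True)
    moreover have "carrier (free_group ({} :: ('i \<times> 'a set) set)) = {\<one>\<^bsub>free_group {}\<^esub>}"
      using free_group_generate[of "{} :: ('i \<times> 'a set) set"] group.generate_empty[OF group_free_group[of "{} :: ('i \<times> 'a set) set"]] by simp
    ultimately show ?thesis
      by (intro exI[of _ "\<lambda>_. \<one>\<^bsub>A\<^esub>"] exI[of _ "\<lambda>_. \<one>\<^bsub>free_group {}\<^esub>"] exI[of _ "{}"])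
        (auto simp: iso_def hom_def kernel_def bij_betw_def group.is_monoid[OF group_free_group] monoid.l_one)
  next
    case False
    then obtain i0 where i0: "i0 \<in> I" by blast
    interpret amalgamated_copies A ?G C I ?\<iota> i0
    proof (intro amalgamated_copies.intro amalgamated_copies_axioms.intro A.group_axioms G.group_axioms)
      show "subgroup C A" by fact
      show "?\<iota> i \<in> hom A ?G" if "i \<in> I" for i
        by (rule generalized_free_product_inj_hom[where A = A and C = C and I = I and B = B and \<theta> = \<theta>, OF assms that])
      show "?\<iota> i c = ?\<iota> j c" if "i \<in> I" "j \<in> I" "c \<in> C" for i j c
        by (rule generalized_free_product_inj_amalgam[where A = A and C = C and I = I and B = B and \<theta> = \<theta>, OF assms that])
      show "generate ?G (\<Union>i\<in>I. ?\<iota> i ` carrier A) = carrier ?G"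
        by (rule gen)
    qed (rule i0)
    have "\<exists>\<Phi>\<in>hom ?G FA. \<forall>i\<in>I. \<forall>a\<in>carrier A. \<Phi> (?\<iota> i a) = (Y i (a <#\<^bsub>A\<^esub> C), a)"
    proof (rule generalized_free_product_hom_exists[where A = A and C = C and I = I and B = B and \<theta> = \<theta>, OF assms FA.group_axioms])
      show "(\<lambda>a. (Y i (a <#\<^bsub>A\<^esub> C), a)) \<in> hom A FA" if "i \<in> I" for i
        by (rule copy_hom[OF that])
    \<comment> \<open>For \<open>c\<close> in \<open>C\<close> the coset is \<open>C\<close>, whose
      symbol is trivial, so all copies send \<open>c\<close> to the same pair.\<close>
    qed (simp_all add: coset_of_C)
    then obtain \<Phi> where \<Phi>: "\<Phi> \<in> hom ?G FA"
      "\<And>i a. i \<in> I \<Longrightarrow> a \<in> carrier A \<Longrightarrow> \<Phi> (?\<iota> i a) = (Y i (a <#\<^bsub>A\<^esub> C), a)"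
      by blast
    have "snd \<circ> \<Phi> \<in> hom ?G A" "fst \<circ> \<Phi> \<in> iso (?G\<lparr>carrier := kernel ?G A (snd \<circ> \<Phi>)\<rparr>) F"
      using folding_kernel_iso_free[OF \<Phi>] by blast+
    then show ?thesis by blast
  qed
qed

theorem theorem6:
  fixes A :: "('a, 'm) monoid_scheme"
    and C :: "'a set"
    and I :: "'i set"
    and B :: "'i \<Rightarrow> ('b, 'n) monoid_scheme"
    and \<theta> :: "'i \<Rightarrow> 'a \<Rightarrow> 'b"
  assumes "torsion_free_group A"
    and "nilpotent_group A"
    and "subgroup C A"
    and "\<And>i. i \<in> I \<Longrightarrow> group (B i)"
    and "\<And>i. i \<in> I \<Longrightarrow> \<theta> i \<in> iso A (B i)"
  shows "(\<exists>(N :: ('i \<times> 'b) list set set monoid) (Q :: ('i \<times> 'b) list set set set monoid).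
            is_free_group N \<and> nilpotent_group Q \<and>
            is_extension (generalized_free_product I B C \<theta>) N Q)
         \<and> residually_solvable (generalized_free_product I B C \<theta>)"
proof -
  have A: "group A" using assms(2) by (simp add: nilpotent_group_def)
  let ?G = "generalized_free_product I B C \<theta>"
  have G: "group ?G"
    by (rule group_generalized_free_product[where A = A and C = C and I = I and B = B and \<theta> = \<theta>, OF A assms(3-5)])
  have "\<exists>p r (X :: ('i \<times> 'a set) set). p \<in> hom ?G A \<and> r \<in> iso (?G\<lparr>carrier := kernel ?G A p\<rparr>) (free_group X)"
    by (rule generalized_free_product_free_by_retract[where A = A and C = C and I = I and B = B and \<theta> = \<theta>, OF A assms(3-5)])
  then obtain p r and X :: "('i \<times> 'a set) set"
    where "p \<in> hom ?G A" "r \<in> iso (?G\<lparr>carrier := kernel ?G A p\<rparr>) (free_group X)"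
    by blast
  then show ?thesis by (rule free_by_nilpotent[OF G assms(2)])
qed

end
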